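(* In the quadratic linear-model setting of the context ($\ell_i(u)=(u-b_i)^2/2$ and $\|a_i\|\le R$ for all $i$), fix $\delta\in(0,1)$ and suppose $n>\frac{28}{3}\log\left(\frac{2d}{\delta}\right)$. Let $$\mu=\frac12\left(\frac{28R^2}{3n}\log\left(\frac{2d}{\delta}\right)-\lambda\right)^+ .$$ Then, with probability at least $1-\delta$, $$\left(\frac32+\frac{2\mu}{\lambda}\right)^{-1}(H_f+\mu I_d)\preceq H_F\preceq 2\,(H_f+\mu I_d).$$ Thus, for this choice of $\mu$ and with $\phi(x)=f(x)+\frac{\mu}{2}\|x\|^2$, with probability at least $1-\delta$ the function $F$ is $L_{F/\phi}$-smooth and $\sigma_{F/\phi}$-strongly convex relative to $\phi$ with $L_{F/\phi}=2$ and $\sigma_{F/\phi}=\left(\frac32+\frac{2\mu}{\lambda}\right)^{-1}$, and so $$\kappa_{F/\phi}=\frac{L_{F/\phi}}{\sigma_{F/\phi}}=O\left(1+\frac{\kappa_\ell}{n}\log\left(\frac d\delta\right)\right),\qquad \kappa_\ell=\frac{R^2}{\lambda}.$$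
   Context: The data set consists of $N$ samples $(a_i,b_i)$ with $a_i\in\mathbb{R}^d$, $b_i\in\mathbb{R}$, $\|a_i\|\le R$ (Euclidean norm), $R>0$. Let $\lambda>0$ and $\ell(x,z_i)=\ell_i(a_i^\top x)+\frac\lambda2\|x\|^2$ with $\ell_i(u)=(u-b_i)^2/2$. The overall loss $F(x)=\frac1N\sum_{i=1}^N\ell(x,z_i)$ averages over the whole data set; the local loss $f$ is the average of $\ell(x,z)$ over $n$ samples drawn independently and uniformly at random, with replacement, from the data set. The Hessians are constant in $x$: $H_F=\nabla^2F=\mathbb{E}[aa^\top]+\lambda I_d$, where $a$ is uniform over $\{a_1,\dots,a_N\}$, and $H_f=\nabla^2f=\frac1n\sum_{i=1}^n\tilde a_i\tilde a_i^\top+\lambda I_d$, where $\tilde a_1,\dots,\tilde a_n$ are the feature vectors of the drawn samples (i.i.d. copies of $a$). Probability is over the draw of the samples. $(u)^+=\max\{u,0\}$; $\preceq$ is the Loewner order; $I_d$ is the identity matrix. $F$ is $L_{F/\phi}$-smooth and $\sigma_{F/\phi}$-strongly convex relative to $\phi$ if $\sigma_{F/\phi}\nabla^2\phi(x)\preceq\nabla^2F(x)\preceq L_{F/\phi}\nabla^2\phi(x)$ for all $x$. The $O(\cdot)$ hides an absolute constant, in the regime $d/\delta\ge2$. *)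

theory Defs
  imports "HOL-Probability.Probability"
begin

text \<open>
  A sample is a pair \<open>(a, b)\<close> of a feature vector and a label; a collection of \<open>m\<close> samples is the
  restriction of a function on \<open>nat\<close> to the indices below \<open>m\<close>. The same averaged loss serves for
  the whole data set and for a drawn sub-sample.
\<close>

definition quad_loss :: "real \<Rightarrow> real \<Rightarrow> real" where
  "quad_loss b u = (u - b)\<^sup>2 / 2"

definition sample_loss :: "real \<Rightarrow> real ^ 'd \<Rightarrow> (real ^ 'd) \<times> real \<Rightarrow> real" where
  "sample_loss lam x z = quad_loss (snd z) (fst z \<bullet> x) + lam / 2 * (norm x)\<^sup>2"

definition avg_loss :: "real \<Rightarrow> nat \<Rightarrow> (nat \<Rightarrow> (real ^ 'd) \<times> real) \<Rightarrow> real ^ 'd \<Rightarrow> real" where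
  "avg_loss lam m z x = (\<Sum>i<m. sample_loss lam x (z i)) / real m"

definition outer :: "real ^ 'd \<Rightarrow> real ^ 'd ^ 'd" where
  "outer v = (\<chi> i j. v $ i * v $ j)"

definition avg_hessian :: "real \<Rightarrow> nat \<Rightarrow> (nat \<Rightarrow> real ^ 'd) \<Rightarrow> real ^ 'd ^ 'd" where
  "avg_hessian lam m a = (1 / real m) *\<^sub>R (\<Sum>i<m. outer (a i)) + lam *\<^sub>R mat 1"

definition loewner_le :: "real ^ 'd ^ 'd \<Rightarrow> real ^ 'd ^ 'd \<Rightarrow> bool" (infix \<open>\<preceq>\<close> 50) where
  "A \<preceq> B \<longleftrightarrow> transpose (B - A) = B - A \<and> (\<forall>v. 0 \<le> v \<bullet> ((B - A) *v v))"

definition has_hessian :: "(real ^ 'd \<Rightarrow> real) \<Rightarrow> real ^ 'd ^ 'd \<Rightarrow> real ^ 'd \<Rightarrow> bool" where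
  "has_hessian f H x \<longleftrightarrow>
     (\<exists>g. (\<forall>\<^sub>F y in nhds x. GDERIV f y :> g y) \<and> (g has_derivative (\<lambda>h. H *v h)) (at x))"

definition rel_smooth_strongly_convex ::
    "(real ^ 'd \<Rightarrow> real) \<Rightarrow> (real ^ 'd \<Rightarrow> real) \<Rightarrow> real \<Rightarrow> real \<Rightarrow> bool" where
  "rel_smooth_strongly_convex F \<phi> L \<sigma> \<longleftrightarrow>
     (\<forall>x. \<exists>HF H\<phi>. has_hessian F HF x \<and> has_hessian \<phi> H\<phi> x \<and>
        \<sigma> *\<^sub>R H\<phi> \<preceq> HF \<and> HF \<preceq> L *\<^sub>R H\<phi>)"

definition reg_mu :: "nat \<Rightarrow> nat \<Rightarrow> real \<Rightarrow> real \<Rightarrow> real \<Rightarrow> real" where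
  "reg_mu d n R lam \<delta> =
     1 / 2 * max (28 * R\<^sup>2 / (3 * real n) * ln (2 * real d / \<delta>) - lam) 0"

definition rel_sigma :: "real \<Rightarrow> real \<Rightarrow> real" where
  "rel_sigma lam \<mu> = inverse (3 / 2 + 2 * \<mu> / lam)"

lemma has_hessian_unique:
  assumes "has_hessian f H x" "has_hessian f H' x"
  shows "H = H'"
proof -
  obtain g g' where g: "\<forall>\<^sub>F y in nhds x. GDERIV f y :> g y" "(g has_derivative (\<lambda>h. H *v h)) (at x)"
    and g': "\<forall>\<^sub>F y in nhds x. GDERIV f y :> g' y" "(g' has_derivative (\<lambda>h. H' *v h)) (at x)"
    using assms unfolding has_hessian_def by blast
  have eq: "g y = g' y" if "GDERIV f y :> g y" "GDERIV f y :> g' y" for y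
  proof -
    have "(\<lambda>h. h \<bullet> g y) = (\<lambda>h. h \<bullet> g' y)"
      using that has_derivative_unique unfolding gderiv_def by blast
    then show ?thesis by (metis vector_eq_ldot)
  qed
  have ev: "\<forall>\<^sub>F y in nhds x. g y = g' y"
    using g(1) g'(1) by eventually_elim (rule eq)
  have "\<forall>\<^sub>F y in at x. g y = g' y"
    using ev unfolding eventually_at_filter by (rule eventually_mono) simp
  moreover have "g x = g' x"
    using ev by (rule eventually_nhds_x_imp_x)
  ultimately have "(g' has_derivative (\<lambda>h. H *v h)) (at x)"
    by (intro has_derivative_transform_eventually[OF g(2)]) auto
  then have "(\<lambda>h. H *v h) = (\<lambda>h. H' *v h)"
    using g'(2) has_derivative_unique by blast
  then show ?thesis by (metis matrix_eq)
qed

lemma outer_mult_vec: "outer v *v h = (v \<bullet> h) *\<^sub>R v"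
  by (simp add: vec_eq_iff outer_def matrix_vector_mult_def inner_vec_def sum_distrib_left mult_ac)

lemma sum_matrix_vector_mult:
  fixes A :: "nat \<Rightarrow> real ^ 'd ^ 'd"
  shows "(\<Sum>i<m. A i) *v h = (\<Sum>i<m. A i *v h)"
  by (induction m) (simp_all add: matrix_vector_mult_add_rdistrib)

lemma avg_hessian_mult_vec:
  "avg_hessian lam m a *v h = (1 / real m) *\<^sub>R (\<Sum>i<m. (a i \<bullet> h) *\<^sub>R a i) + lam *\<^sub>R h"
  by (simp add: avg_hessian_def matrix_vector_mult_add_rdistrib scaleR_matrix_vector_assoc[symmetric]
      sum_matrix_vector_mult outer_mult_vec)

text \<open>The matrix \<^const>\<open>avg_hessian\<close> is the Hessian of the averaged loss, at every point.\<close>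

lemma has_hessian_avg_loss:
  assumes "m > 0"
  shows "has_hessian (avg_loss lam m z) (avg_hessian lam m (\<lambda>i. fst (z i))) x"
proof -
  let ?g = "\<lambda>y. (1 / real m) *\<^sub>R (\<Sum>i<m. (fst (z i) \<bullet> y - snd (z i)) *\<^sub>R fst (z i)) + lam *\<^sub>R y"
  have sample: "((\<lambda>y. sample_loss lam y (z i)) has_derivative
      (\<lambda>h. (fst (z i) \<bullet> y - snd (z i)) * (fst (z i) \<bullet> h) + lam * (y \<bullet> h))) (at y)" for i y
    unfolding sample_loss_def quad_loss_def power2_norm_eq_inner
    unfolding power2_eq_square
    by (auto intro!: derivative_eq_intros simp: fun_eq_iff inner_commute field_simps)
  have "GDERIV (avg_loss lam m z) y :> ?g y" for y
  proof -
    have "((\<lambda>y. (\<Sum>i<m. sample_loss lam y (z i)) / real m) has_derivative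
        (\<lambda>h. (\<Sum>i<m. (fst (z i) \<bullet> y - snd (z i)) * (fst (z i) \<bullet> h) + lam * (y \<bullet> h)) / real m))
        (at y)"
      by (intro bounded_linear.has_derivative[OF bounded_linear_divide] has_derivative_sum sample)
    moreover have "(\<Sum>i<m. (fst (z i) \<bullet> y - snd (z i)) * (fst (z i) \<bullet> h) + lam * (y \<bullet> h)) / real m
        = h \<bullet> ?g y" for h
      using assms by (simp add: inner_add_right inner_sum_right sum.distrib add_divide_distrib
          inner_commute)
    ultimately show ?thesis
      unfolding gderiv_def avg_loss_def[abs_def] by simp
  qed
  moreover have "(?g has_derivative (\<lambda>h. avg_hessian lam m (\<lambda>i. fst (z i)) *v h)) (at x)"
  proof -
    have "((\<lambda>y. (fst (z i) \<bullet> y - snd (z i)) *\<^sub>R fst (z i)) has_derivative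
        (\<lambda>h. (fst (z i) \<bullet> h) *\<^sub>R fst (z i))) (at x)" for i
      by (auto intro!: derivative_eq_intros)
    then show ?thesis
      unfolding avg_hessian_mult_vec
      by (intro has_derivative_add has_derivative_scaleR_right has_derivative_sum has_derivative_ident)
  qed
  ultimately show ?thesis
    unfolding has_hessian_def by (intro exI[of _ ?g]) simp
qed

end

theory Submission
  imports Defs
begin

text \<open>
  Both Loewner inequalities follow from one-sided bounds on the largest eigenvalue of a sum of
  independent symmetric matrices \<open>\<theta> (\<alpha> H + \<beta> a a\<^sup>T)\<close>, where \<open>H\<close> is the expectation of \<open>a a\<^sup>T\<close>,
  with \<open>(\<alpha>, \<beta>) = (1, -2)\<close> and \<open>(-3/2, 1)\<close>. The sum is not centred: for small \<open>\<theta>\<close> the negative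
  mean dominates the second moment, so the matrix moment generating function of a summand is at
  most the identity, and the argument of Ahlswede and Winter gives the tail bound \<open>d e\<^sup>-\<^sup>t\<close>.
  Exponentials and the spectral theorem are avoided by replacing \<open>exp A\<close> with
  \<open>(1 + A/m)\<^sup>m\<close>, \<open>m = 2\<^sup>k\<close>, and the Golden--Thompson inequality with
  \<open>tr (PQ)\<^sup>m \<le> tr P\<^sup>m Q\<^sup>m\<close> for symmetric \<open>P\<close>, \<open>Q\<close>; the error of this replacement vanishes as
  \<open>k\<close> tends to infinity. Since the samples are uniform on a finite set, expectations are averages
  over the finitely many index sequences.
\<close>

section \<open>Matrix powers and traces\<close>

primrec mat_pow :: "real ^ 'd ^ 'd \<Rightarrow> nat \<Rightarrow> real ^ 'd ^ 'd" where
  "mat_pow A 0 = mat 1"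
| "mat_pow A (Suc k) = A ** mat_pow A k"

lemma mat_pow_add: "mat_pow A (j + k) = mat_pow A j ** mat_pow A k"
  by (induction j) (simp_all add: matrix_mul_assoc)

lemma mat_pow_mult: "mat_pow A (j * k) = mat_pow (mat_pow A j) k"
  by (induction k) (simp_all add: mat_pow_add)

lemma mat_pow_commute: "A ** mat_pow A k = mat_pow A k ** A"
proof (induction k)
  case (Suc k)
  show ?case
    by (simp only: mat_pow.simps matrix_mul_assoc[symmetric] Suc.IH[symmetric])
qed simp

lemma mat_pow_two: "mat_pow A 2 = A ** A"
  by (simp add: numeral_2_eq_2)

lemma transpose_mat_pow: "transpose (mat_pow A k) = mat_pow (transpose A) k"
  by (induction k) (simp_all add: matrix_transpose_mul mat_pow_commute)

lemma mat_pow_shift: "A ** mat_pow (B ** A) k = mat_pow (A ** B) k ** A"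
  for A B :: "real ^ 'd ^ 'd"
proof (induction k)
  case (Suc k)
  have "A ** mat_pow (B ** A) (Suc k) = (A ** B) ** (A ** mat_pow (B ** A) k)"
    by (simp add: matrix_mul_assoc)
  then show ?case
    by (simp add: Suc matrix_mul_assoc)
qed simp

text \<open>Splitting one factor off the power lets \<open>trace_mul_sym\<close> carry
  \<open>A\<close> to the other end, and \<open>mat_pow_shift\<close> regroups what remains.\<close>

lemma trace_mat_pow_commute: "trace (mat_pow (A ** B) k) = trace (mat_pow (B ** A) k)"
  for A B :: "real ^ 'd ^ 'd"
proof (cases k)
  case (Suc j)
  have "trace (mat_pow (A ** B) k) = trace (A ** (B ** mat_pow (A ** B) j))"
    by (simp add: Suc matrix_mul_assoc)
  also have "\<dots> = trace ((B ** mat_pow (A ** B) j) ** A)"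
    by (rule trace_mul_sym)
  also have "(B ** mat_pow (A ** B) j) ** A = mat_pow (B ** A) j ** (B ** A)"
    unfolding mat_pow_shift by (simp add: matrix_mul_assoc)
  also have "\<dots> = mat_pow (B ** A) k"
    by (simp add: Suc mat_pow_commute)
  finally show ?thesis .
qed simp

lemma symmetric_inner:
  fixes A :: "real ^ 'd ^ 'd"
  assumes "transpose A = A"
  shows "(A *v x) \<bullet> y = x \<bullet> (A *v y)"
  using assms dot_lmul_matrix[of x A y] transpose_matrix_vector[of A x] by simp

lemma trace_mult_transpose: "trace (A ** transpose B) = A \<bullet> B"
  for A B :: "real ^ 'd ^ 'd"
  by (simp add: trace_def matrix_matrix_mult_def transpose_def inner_vec_def)

text \<open>Expansion of the squared Frobenius norm of \<open>A - transpose B\<close>, which is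
  nonnegative.\<close>

lemma trace_mult_le:
  fixes A B :: "real ^ 'd ^ 'd"
  shows "2 * trace (A ** B) \<le> trace (A ** transpose A) + trace (transpose B ** B)"
proof -
  have "0 \<le> (A - transpose B) \<bullet> (A - transpose B)"
    by simp
  moreover have "transpose B \<bullet> transpose B = trace (transpose B ** B)" "A \<bullet> transpose B = trace (A ** B)"
    using trace_mult_transpose[of "transpose B" "transpose B"] trace_mult_transpose[of A "transpose B"]
    by simp_all
  ultimately show ?thesis
    by (simp add: trace_mult_transpose inner_diff_left inner_diff_right inner_commute)
qed

text \<open>
  The two inequalities are proved simultaneously: each one at \<open>k + 1\<close> uses the first one at \<open>k\<close>.
  The first one is Weyl's inequality comparing eigenvalues with singular values.
\<close>

lemma trace_pow_two_power_aux:
  "(\<forall>Z :: real ^ 'd ^ 'd. trace (mat_pow Z (2 * 2 ^ k)) \<le> trace (mat_pow (Z ** transpose Z) (2 ^ k))) \<and>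
   (\<forall>P Q :: real ^ 'd ^ 'd. transpose P = P \<longrightarrow> transpose Q = Q \<longrightarrow>
      trace (mat_pow (P ** Q) (2 ^ k)) \<le> trace (mat_pow P (2 ^ k) ** mat_pow Q (2 ^ k)))"
proof (induction k)
  case 0
  have "trace (mat_pow Z 2) \<le> trace (Z ** transpose Z)" for Z :: "real ^ 'd ^ 'd"
    using trace_mult_le[of Z Z] trace_mul_sym[of "transpose Z" Z] by (simp add: mat_pow_two)
  then show ?case by simp
next
  case (Suc k)
  then have IH1: "trace (mat_pow Z (2 * 2 ^ k)) \<le> trace (mat_pow (Z ** transpose Z) (2 ^ k))"
    and IH2: "transpose P = P \<Longrightarrow> transpose Q = Q \<Longrightarrow>
      trace (mat_pow (P ** Q) (2 ^ k)) \<le> trace (mat_pow P (2 ^ k) ** mat_pow Q (2 ^ k))"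
    for Z P Q :: "real ^ 'd ^ 'd"
    by blast+
  have "trace (mat_pow Z (2 * 2 ^ Suc k)) \<le> trace (mat_pow (Z ** transpose Z) (2 ^ Suc k))"
    for Z :: "real ^ 'd ^ 'd"
  proof -
    let ?m = "2 ^ Suc k :: nat" and ?P = "transpose Z ** Z" and ?Q = "Z ** transpose Z"
    have sym: "transpose ?P = ?P" "transpose ?Q = ?Q"
      by (simp_all add: matrix_transpose_mul)
    have PQ: "trace (mat_pow ?P j) = trace (mat_pow ?Q j)" for j
      by (rule trace_mat_pow_commute)
    \<comment> \<open>Squaring \<open>Z\<close> halves the exponent, so that the first induction
      hypothesis applies to \<open>Z ** Z\<close>.\<close>
    have "trace (mat_pow Z (2 * ?m)) = trace (mat_pow (Z ** Z) (2 * 2 ^ k))"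
      by (simp only: mat_pow_mult mat_pow_two power_Suc)
    also have "\<dots> \<le> trace (mat_pow ((Z ** Z) ** transpose (Z ** Z)) (2 ^ k))"
      by (rule IH1)
    also have "(Z ** Z) ** transpose (Z ** Z) = Z ** (Z ** transpose Z ** transpose Z)"
      by (simp add: matrix_transpose_mul matrix_mul_assoc)
    \<comment> \<open>Moving the leading \<open>Z\<close> to the end turns the product into
      \<open>?Q ** ?P\<close>. Both factors are symmetric, which the second induction hypothesis
      requires.\<close>
    also have "trace (mat_pow (Z ** (Z ** transpose Z ** transpose Z)) (2 ^ k)) =
        trace (mat_pow (?Q ** ?P) (2 ^ k))"
      by (subst trace_mat_pow_commute) (simp add: matrix_mul_assoc)
    also have "\<dots> \<le> trace (mat_pow ?Q (2 ^ k) ** mat_pow ?P (2 ^ k))"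
      by (intro IH2 sym)
    \<comment> \<open>Averaging the two traces loses nothing, since by \<open>PQ\<close> all powers
      of \<open>?P\<close> and \<open>?Q\<close> have equal traces.\<close>
    also have "\<dots> \<le> (trace (mat_pow ?Q ?m) + trace (mat_pow ?P ?m)) / 2"
      using trace_mult_le[of "mat_pow ?Q (2 ^ k)" "mat_pow ?P (2 ^ k)"]
      unfolding transpose_mat_pow sym mat_pow_add[symmetric] mult_2[symmetric] power_Suc[symmetric]
      by simp
    also have "\<dots> = trace (mat_pow ?Q ?m)"
      by (simp add: PQ)
    finally show ?thesis .
  qed
  moreover have "trace (mat_pow (P ** Q) (2 ^ Suc k)) \<le>
      trace (mat_pow P (2 ^ Suc k) ** mat_pow Q (2 ^ Suc k))"
    if P: "transpose P = P" and Q: "transpose Q = Q" for P Q :: "real ^ 'd ^ 'd"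
  proof -
    \<comment> \<open>The first induction hypothesis for \<open>P ** Q\<close> produces
      \<open>P ** Q ** Q ** P\<close>. A cyclic rotation makes this a product of the squares of
      \<open>Q\<close> and \<open>P\<close>, to which the second hypothesis applies.\<close>
    have "trace (mat_pow (P ** Q) (2 ^ Suc k)) \<le>
        trace (mat_pow ((P ** Q) ** transpose (P ** Q)) (2 ^ k))"
      unfolding power_Suc by (rule IH1)
    also have "(P ** Q) ** transpose (P ** Q) = P ** (Q ** Q ** P)"
      by (simp only: matrix_transpose_mul matrix_mul_assoc P Q)
    also have "trace (mat_pow (P ** (Q ** Q ** P)) (2 ^ k)) =
        trace (mat_pow ((Q ** Q) ** (P ** P)) (2 ^ k))"
      by (subst trace_mat_pow_commute) (simp add: matrix_mul_assoc)
    also have "\<dots> \<le> trace (mat_pow (Q ** Q) (2 ^ k) ** mat_pow (P ** P) (2 ^ k))"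
      by (rule IH2) (simp_all only: matrix_transpose_mul P Q)
    also have "\<dots> = trace (mat_pow P (2 ^ Suc k) ** mat_pow Q (2 ^ Suc k))"
      by (subst trace_mul_sym) (simp only: mat_pow_mult[of _ 2] mat_pow_two power_Suc)
    finally show ?thesis .
  qed
  ultimately show ?case by blast
qed

lemma trace_pow_product_le:
  fixes P Q :: "real ^ 'd ^ 'd"
  assumes "transpose P = P" "transpose Q = Q"
  shows "trace (mat_pow (P ** Q) (2 ^ k)) \<le> trace (mat_pow P (2 ^ k) ** mat_pow Q (2 ^ k))"
  using trace_pow_two_power_aux assms by blast

section \<open>The Lie--Trotter approximation\<close>

text \<open>The norm of a matrix in the type \<^typ>\<open>real ^ 'd ^ 'd\<close> is the Frobenius norm.\<close>

lemma norm_matrix_vector_le: "norm (A *v v) \<le> norm A * norm v"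
  for A :: "real ^ 'd ^ 'd"
proof -
  have "(norm (A *v v))\<^sup>2 = (\<Sum>i\<in>UNIV. (A $ i \<bullet> v)\<^sup>2)"
    unfolding power2_norm_eq_inner
    by (simp add: inner_vec_def[of "A *v v"] matrix_vector_mul_component power2_eq_square)
  also have "\<dots> \<le> (\<Sum>i\<in>UNIV. (norm (A $ i))\<^sup>2 * (norm v)\<^sup>2)"
    by (intro sum_mono) (metis Cauchy_Schwarz_ineq power2_norm_eq_inner)
  also have "\<dots> = (norm A * norm v)\<^sup>2"
    by (simp add: power_mult_distrib sum_distrib_right[symmetric] power2_norm_eq_inner inner_vec_def[of A])
  finally show ?thesis
    by (rule power2_le_imp_le) simp
qed

text \<open>The Frobenius norm is read off the columns, so the bound for matrix products reduces to
  \<open>norm_matrix_vector_le\<close> on each column of the second factor.\<close>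

lemma norm_sq_eq_sum_basis: "(norm A)\<^sup>2 = (\<Sum>j\<in>UNIV. (norm (A *v axis j 1))\<^sup>2)"
  for A :: "real ^ 'd ^ 'd"
proof -
  have "(norm A)\<^sup>2 = (\<Sum>i\<in>UNIV. \<Sum>j\<in>UNIV. (A $ i $ j)\<^sup>2)"
    unfolding power2_norm_eq_inner by (simp add: inner_vec_def power2_eq_square)
  also have "\<dots> = (\<Sum>j\<in>UNIV. \<Sum>i\<in>UNIV. (A $ i $ j)\<^sup>2)"
    by (rule sum.swap)
  also have "\<dots> = (\<Sum>j\<in>UNIV. (norm (A *v axis j 1))\<^sup>2)"
    unfolding power2_norm_eq_inner
    by (simp add: inner_vec_def[of "_ *v _"] matrix_vector_mul_component inner_axis power2_eq_square)
  finally show ?thesis .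
qed

lemma norm_matrix_mult_le: "norm (A ** B) \<le> norm A * norm B"
  for A B :: "real ^ 'd ^ 'd"
proof -
  have "(norm (A ** B))\<^sup>2 = (\<Sum>j\<in>UNIV. (norm (A *v (B *v axis j 1)))\<^sup>2)"
    by (simp add: norm_sq_eq_sum_basis matrix_vector_mul_assoc)
  also have "\<dots> \<le> (\<Sum>j\<in>UNIV. (norm A * norm (B *v axis j 1))\<^sup>2)"
    by (intro sum_mono power_mono norm_matrix_vector_le) simp
  also have "\<dots> = (norm A * norm B)\<^sup>2"
    by (simp add: power_mult_distrib sum_distrib_left[symmetric] norm_sq_eq_sum_basis[of B])
  finally show ?thesis
    by (rule power2_le_imp_le) simp
qed

lemma abs_trace_le: "\<bar>trace A\<bar> \<le> real CARD('d) * norm A"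
  for A :: "real ^ 'd ^ 'd"
proof -
  have "\<bar>trace A\<bar> \<le> (\<Sum>i\<in>UNIV. \<bar>A $ i $ i\<bar>)"
    unfolding trace_def by (rule sum_abs)
  also have "\<dots> \<le> (\<Sum>i\<in>(UNIV :: 'd set). norm A)"
    by (intro sum_mono order_trans[OF component_le_norm_cart Finite_Cartesian_Product.norm_nth_le])
  finally show ?thesis by simp
qed

lemma matrix_scaleR_mult:
  fixes A B :: "real ^ 'd ^ 'd"
  shows "(c *\<^sub>R A) ** B = c *\<^sub>R (A ** B)" "A ** (c *\<^sub>R B) = c *\<^sub>R (A ** B)"
  by (simp_all add: matrix_matrix_mult_def vec_eq_iff sum_distrib_left mult_ac)

lemma matrix_diff_distrib:
  fixes A B C :: "real ^ 'd ^ 'd"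
  shows "(A - B) ** C = A ** C - B ** C" "C ** (A - B) = C ** A - C ** B"
  by (simp_all add: matrix_matrix_mult_def vec_eq_iff sum_subtractf algebra_simps)

lemma matrix_add_rdistrib: "(A + B) ** C = A ** C + B ** C"
  for A B C :: "real ^ 'd ^ 'd"
  by (simp add: matrix_matrix_mult_def vec_eq_iff sum.distrib algebra_simps)

text \<open>The product is expanded before norms are taken. The Frobenius norm of the identity is
  the square root of the dimension, and submultiplicativity alone would pay this factor at every
  multiplication.\<close>

lemma norm_perturbed_identity_mult_le:
  fixes U X :: "real ^ 'd ^ 'd"
  assumes "norm U \<le> u" "h \<ge> 0"
  shows "norm ((mat 1 + h *\<^sub>R U) ** X) \<le> (1 + h * u) * norm X"
proof -
  have "norm ((mat 1 + h *\<^sub>R U) ** X) = norm (X + h *\<^sub>R (U ** X))"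
    by (simp add: matrix_add_rdistrib matrix_scaleR_mult)
  also have "\<dots> \<le> norm X + h * norm (U ** X)"
    using norm_triangle_ineq[of X "h *\<^sub>R (U ** X)"] assms by simp
  also have "\<dots> \<le> norm X + h * (u * norm X)"
    using assms norm_matrix_mult_le[of U X]
    by (intro add_left_mono mult_left_mono) (auto intro: order_trans[OF _ mult_right_mono])
  finally show ?thesis by (simp add: algebra_simps)
qed

lemma norm_perturbed_identity_pow_le:
  fixes U :: "real ^ 'd ^ 'd"
  assumes "norm U \<le> u" "h \<ge> 0"
  shows "norm (mat_pow (mat 1 + h *\<^sub>R U) k) \<le> (1 + h * u) ^ k * norm (mat 1 :: real ^ 'd ^ 'd)"
proof (induction k)
  case (Suc k)
  have u: "u \<ge> 0" using assms norm_ge_zero order_trans by blast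
  have "norm (mat_pow (mat 1 + h *\<^sub>R U) (Suc k)) \<le> (1 + h * u) * norm (mat_pow (mat 1 + h *\<^sub>R U) k)"
    using norm_perturbed_identity_mult_le[OF assms] by simp
  also have "\<dots> \<le> (1 + h * u) * ((1 + h * u) ^ k * norm (mat 1 :: real ^ 'd ^ 'd))"
    using Suc assms u by (intro mult_left_mono) auto
  finally show ?case by (simp add: mult.assoc)
qed simp

text \<open>Telescoping: with \<open>?P\<close> and \<open>?Q\<close> the two perturbed identities,
  the difference of their powers at \<open>Suc k\<close> is \<open>?P\<close> times the difference
  at \<open>k\<close>, plus \<open>?P - ?Q\<close> times a power of \<open>?Q\<close>.\<close>

lemma norm_pow_diff_le:
  fixes U V :: "real ^ 'd ^ 'd"
  assumes "norm U \<le> u" "norm V \<le> u" "h \<ge> 0"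
  shows "norm (mat_pow (mat 1 + h *\<^sub>R U) k - mat_pow (mat 1 + h *\<^sub>R V) k)
    \<le> real k * (h * norm (U - V)) * (1 + h * u) ^ k * norm (mat 1 :: real ^ 'd ^ 'd)"
proof (induction k)
  case (Suc k)
  let ?P = "mat 1 + h *\<^sub>R U" and ?Q = "mat 1 + h *\<^sub>R V" and ?I = "norm (mat 1 :: real ^ 'd ^ 'd)"
  let ?g = "1 + h * u" and ?e = "h * norm (U - V)"
  have u: "u \<ge> 0" using assms norm_ge_zero order_trans by blast
  have g: "?g \<ge> 1" using assms u by simp
  have e: "?e \<ge> 0" using assms by simp
  have PQ: "?P - ?Q = h *\<^sub>R (U - V)" by (simp add: algebra_simps)
  have "mat_pow ?P (Suc k) - mat_pow ?Q (Suc k) =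
      ?P ** (mat_pow ?P k - mat_pow ?Q k) + (?P - ?Q) ** mat_pow ?Q k"
    unfolding matrix_diff_distrib by simp
  then have "norm (mat_pow ?P (Suc k) - mat_pow ?Q (Suc k))
      \<le> norm (?P ** (mat_pow ?P k - mat_pow ?Q k)) + norm ((?P - ?Q) ** mat_pow ?Q k)"
    by (metis norm_triangle_ineq)
  also have "\<dots> \<le> ?g * norm (mat_pow ?P k - mat_pow ?Q k) + ?e * norm (mat_pow ?Q k)"
    using norm_perturbed_identity_mult_le[of U u h] norm_matrix_mult_le[of "?P - ?Q" "mat_pow ?Q k"]
      assms unfolding PQ by (intro add_mono) auto
  also have "\<dots> \<le> ?g * (real k * ?e * ?g ^ k * ?I) + ?e * (?g ^ k * ?I)"
    using Suc g e norm_perturbed_identity_pow_le[of V u h k] assms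
    by (intro add_mono mult_left_mono) auto
  \<comment> \<open>A spare factor \<open>?g\<close>, which is at least 1, gives both summands the
    same power.\<close>
  also have "?e * (?g ^ k * ?I) \<le> ?e * (?g ^ Suc k * ?I)"
    using g e by (intro mult_left_mono mult_right_mono power_increasing) auto
  finally show ?case by (simp add: algebra_simps)
qed simp

text \<open>The product of the two perturbed identities is again a perturbed identity whose
  generator differs from \<open>S + X\<close> by \<open>S ** X\<close> divided by \<open>m\<close>.
  Hence the \<open>m\<close>-th powers differ by order \<open>1 / m\<close>.\<close>

lemma lie_trotter_trace:
  fixes S X :: "real ^ 'd ^ 'd"
  shows "(\<lambda>m. trace (mat_pow (mat 1 + (1 / real m) *\<^sub>R (S + X)) m) -
      trace (mat_pow ((mat 1 + (1 / real m) *\<^sub>R S) ** (mat 1 + (1 / real m) *\<^sub>R X)) m)) \<longlonglongrightarrow> 0"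
    (is "?D \<longlonglongrightarrow> 0")
proof -
  \<comment> \<open>A bound on both generators that does not depend on \<open>m\<close>; it keeps
    the powers below \<open>exp u\<close>.\<close>
  define u where "u = norm (S + X) + norm (S ** X)"
  let ?I = "norm (mat 1 :: real ^ 'd ^ 'd)"
  define K where "K = real CARD('d) * (norm (S ** X) * exp u * ?I)"
  have "norm (?D m) \<le> K / real m" if m: "m \<ge> 1" for m
  proof -
    let ?h = "1 / real m"
    let ?V = "S + X + ?h *\<^sub>R (S ** X)"
    have P: "(mat 1 + ?h *\<^sub>R S) ** (mat 1 + ?h *\<^sub>R X) = mat 1 + ?h *\<^sub>R ?V"
      by (simp only: matrix_add_ldistrib matrix_add_rdistrib matrix_scaleR_mult matrix_mul_lid
          matrix_mul_rid scaleR_add_right scaleR_scaleR add_ac)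
    have "?h * norm (S ** X) \<le> norm (S ** X)"
      using m by (intro mult_left_le_one_le) auto
    then have V: "norm ?V \<le> u"
      unfolding u_def using norm_triangle_ineq[of "S + X" "?h *\<^sub>R (S ** X)"] by simp
    have U: "norm (S + X) \<le> u"
      by (simp add: u_def)
    have "(1 + ?h * u) ^ m \<le> exp (?h * u) ^ m"
      by (intro power_mono exp_ge_add_one_self add_nonneg_nonneg mult_nonneg_nonneg)
        (auto simp: u_def)
    also have "\<dots> = exp u"
      using m by (simp add: exp_of_nat_mult[symmetric])
    finally have E: "(1 + ?h * u) ^ m \<le> exp u" .
    have "norm (?D m) \<le> real CARD('d) *
        norm (mat_pow (mat 1 + ?h *\<^sub>R (S + X)) m - mat_pow (mat 1 + ?h *\<^sub>R ?V) m)"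
      unfolding P trace_sub[symmetric] real_norm_def by (rule abs_trace_le)
    also have "\<dots> \<le> real CARD('d) * (real m * (?h * norm (S + X - ?V)) * (1 + ?h * u) ^ m * ?I)"
      using U V by (intro mult_left_mono norm_pow_diff_le) auto
    also have "real m * (?h * norm (S + X - ?V)) = norm (S ** X) / real m"
      using m by simp
    also have "real CARD('d) * (norm (S ** X) / real m * (1 + ?h * u) ^ m * ?I) \<le>
        real CARD('d) * (norm (S ** X) / real m * exp u * ?I)"
      using E by (intro mult_left_mono mult_right_mono) auto
    finally show ?thesis by (simp add: K_def)
  qed
  then have "\<forall>\<^sub>F m in sequentially. norm (?D m) \<le> K / real m"
    by (intro eventually_mono[OF eventually_ge_at_top[of 1]]) blast
  moreover have "(\<lambda>m. K / real m) \<longlonglongrightarrow> 0"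
    by (rule lim_const_over_n)
  ultimately show ?thesis
    by (rule Lim_null_comparison)
qed

section \<open>Quadratic upper bound for the substitute exponential\<close>

text \<open>In the binomial expansion every term of degree at least 2 carries a factor
  \<open>X\<close> on each side. The middle factor \<open>Q\<close> is a polynomial in
  \<open>X\<close> with nonnegative coefficients, and since \<open>X\<close> is a contraction its
  size is at most the scalar remainder. Keeping the outer factors lets the remainder be compared
  with the square of \<open>X\<close>.\<close>

lemma mat_pow_taylor_remainder:
  fixes X :: "real ^ 'd ^ 'd"
  assumes X: "\<And>w. norm (X *v w) \<le> norm w" and h: "h \<ge> 0"
  shows "\<exists>Q. mat_pow (mat 1 + h *\<^sub>R X) k = mat 1 + (real k * h) *\<^sub>R X + X ** Q ** X \<and>
    (\<forall>w. norm (Q *v w) \<le> ((1 + h) ^ k - 1 - real k * h) * norm w)"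
proof (induction k)
  case 0
  show ?case by (rule exI[of _ 0]) simp
next
  case (Suc k)
  define q where "q = (1 + h) ^ k - 1 - real k * h"
  obtain Q where Q: "mat_pow (mat 1 + h *\<^sub>R X) k = mat 1 + (real k * h) *\<^sub>R X + X ** Q ** X"
    and Qw: "\<And>w. norm (Q *v w) \<le> q * norm w"
    using Suc unfolding q_def by blast
  \<comment> \<open>Obtained by multiplying the expansion at \<open>k\<close> by
    \<open>mat 1 + h *\<^sub>R X\<close> and collecting what has degree at least 2.\<close>
  define Q' where "Q' = (real k * h\<^sup>2) *\<^sub>R mat 1 + Q + h *\<^sub>R (X ** Q)"
  have "mat_pow (mat 1 + h *\<^sub>R X) (Suc k) =
      mat 1 + (real k * h) *\<^sub>R X + X ** Q ** X + h *\<^sub>R X + (real k * h\<^sup>2) *\<^sub>R (X ** X)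
        + h *\<^sub>R (X ** (X ** Q ** X))"
    by (simp add: Q matrix_add_ldistrib matrix_add_rdistrib matrix_scaleR_mult scaleR_add_right
        power2_eq_square mult.left_commute)
  also have "\<dots> = mat 1 + (real (Suc k) * h) *\<^sub>R X + X ** Q' ** X"
    by (simp add: Q'_def matrix_add_ldistrib matrix_add_rdistrib matrix_scaleR_mult
        matrix_mul_assoc scaleR_add_left distrib_right)
  finally have "mat_pow (mat 1 + h *\<^sub>R X) (Suc k) = \<dots>" .
  moreover have "norm (Q' *v w) \<le> ((1 + h) ^ Suc k - 1 - real (Suc k) * h) * norm w" for w
  proof -
    have "Q' *v w = (real k * h\<^sup>2) *\<^sub>R w + Q *v w + h *\<^sub>R (X *v (Q *v w))"
      by (simp add: Q'_def matrix_vector_mult_add_rdistrib scaleR_matrix_vector_assoc[symmetric]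
          matrix_vector_mul_assoc)
    then have "norm (Q' *v w) \<le> norm ((real k * h\<^sup>2) *\<^sub>R w) + norm (Q *v w) + norm (h *\<^sub>R (X *v (Q *v w)))"
      by (metis norm_triangle_ineq norm_triangle_le add_right_mono)
    also have "\<dots> \<le> real k * h\<^sup>2 * norm w + norm (Q *v w) + h * norm (Q *v w)"
      using h X[of "Q *v w"] by (simp add: mult_left_mono)
    also have "\<dots> = real k * h\<^sup>2 * norm w + (1 + h) * norm (Q *v w)"
      by (simp add: algebra_simps)
    also have "\<dots> \<le> real k * h\<^sup>2 * norm w + (1 + h) * (q * norm w)"
      using h Qw[of w] by (intro add_left_mono mult_left_mono) auto
    also have "\<dots> = ((1 + h) ^ Suc k - 1 - real (Suc k) * h) * norm w"
      by (simp add: q_def algebra_simps power2_eq_square)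
    finally show ?thesis .
  qed
  ultimately show ?case by blast
qed

text \<open>Matrix counterpart of exp x \<le> 1 + x + x^2 for |x| \<le> 1. By symmetry of
  \<open>X\<close>, the last term is the quadratic form of the square of \<open>X\<close>.\<close>

lemma mat_pow_quadratic_bound:
  fixes X :: "real ^ 'd ^ 'd"
  assumes sym: "transpose X = X" and X: "\<And>w. norm (X *v w) \<le> norm w" and m: "m \<ge> 1"
  shows "v \<bullet> (mat_pow (mat 1 + (1 / real m) *\<^sub>R X) m *v v) \<le> v \<bullet> v + v \<bullet> (X *v v) + (X *v v) \<bullet> (X *v v)"
proof -
  let ?h = "1 / real m" and ?w = "X *v v"
  obtain Q where Q: "mat_pow (mat 1 + ?h *\<^sub>R X) m = mat 1 + (real m * ?h) *\<^sub>R X + X ** Q ** X"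
    and Qw: "\<And>w. norm (Q *v w) \<le> ((1 + ?h) ^ m - 1 - real m * ?h) * norm w"
    using mat_pow_taylor_remainder[OF X, of ?h m] by auto
  have "(1 + ?h) ^ m \<le> exp ?h ^ m"
    by (intro power_mono exp_ge_add_one_self) simp
  also have "\<dots> = exp 1"
    using m by (simp add: exp_of_nat_mult[symmetric])
  \<comment> \<open>The remainder coefficient is at most e - 2, so the crude bound e \<le> 3 already
    yields coefficient 1.\<close>
  also have "\<dots> \<le> 3"
    by (rule exp_le)
  finally have "(1 + ?h) ^ m - 1 - real m * ?h \<le> 1"
    using m by simp
  then have "norm (Q *v ?w) \<le> 1 * norm ?w"
    by (intro order_trans[OF Qw mult_right_mono]) simp_all
  then have "?w \<bullet> (Q *v ?w) \<le> ?w \<bullet> ?w"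
    using norm_cauchy_schwarz[of ?w "Q *v ?w"] mult_left_mono[of "norm (Q *v ?w)" "1 * norm ?w" "norm ?w"]
    by (simp add: dot_square_norm power2_eq_square)
  moreover have "v \<bullet> ((X ** Q ** X) *v v) = ?w \<bullet> (Q *v ?w)"
    by (simp add: matrix_vector_mul_assoc[symmetric] symmetric_inner[OF sym])
  ultimately show ?thesis
    using m by (simp add: Q matrix_vector_mult_add_rdistrib inner_add_right)
qed

section \<open>Traces and quadratic forms\<close>

lemma trace_eq_sum_basis: "trace A = (\<Sum>i\<in>UNIV. axis i 1 \<bullet> (A *v axis i 1))"
  for A :: "real ^ 'd ^ 'd"
  by (simp add: trace_def inner_commute[of "axis _ _"] inner_axis matrix_vector_mul_component)

text \<open>By cyclicity the trace is that of \<open>B ** K ** B\<close>, a sum of values of the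
  form of \<open>K\<close> at the columns of \<open>B\<close>.\<close>

lemma trace_sandwich_le:
  fixes B K :: "real ^ 'd ^ 'd"
  assumes sym: "transpose B = B" and K: "\<And>v. v \<bullet> (K *v v) \<le> c * (v \<bullet> v)"
  shows "trace (B ** B ** K) \<le> c * trace (B ** B)"
proof -
  have "trace (B ** B ** K) = trace (B ** K ** B)"
    using trace_mul_sym[of B "B ** K"] by (simp add: matrix_mul_assoc)
  also have "\<dots> = (\<Sum>i\<in>UNIV. (B *v axis i 1) \<bullet> (K *v (B *v axis i 1)))"
    by (simp add: trace_eq_sum_basis matrix_vector_mul_assoc[symmetric] symmetric_inner[OF sym])
  also have "\<dots> \<le> (\<Sum>i\<in>UNIV. c * ((B *v axis i 1) \<bullet> (B *v axis i 1)))"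
    by (intro sum_mono K)
  also have "\<dots> = c * trace (B ** B)"
    by (simp add: trace_eq_sum_basis matrix_vector_mul_assoc[symmetric] symmetric_inner[OF sym]
        sum_distrib_left)
  finally show ?thesis .
qed

text \<open>Repeated squaring replaces an eigenvector argument: for a unit vector, Cauchy-Schwarz
  bounds the form of a symmetric power by the length of the image of \<open>v\<close>, whose square
  is the form of the squared power.\<close>

lemma rayleigh_pow_two_power:
  fixes P :: "real ^ 'd ^ 'd"
  assumes sym: "transpose P = P" and "norm v = 1" "0 \<le> r" "r \<le> v \<bullet> (P *v v)"
  shows "r ^ 2 ^ k \<le> v \<bullet> (mat_pow P (2 ^ k) *v v)"
proof (induction k)
  case 0
  show ?case using assms by simp
next
  case (Suc k)
  let ?A = "mat_pow P (2 ^ k)"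
  have A: "transpose ?A = ?A"
    by (simp add: transpose_mat_pow sym)
  have "r ^ 2 ^ k \<le> norm (?A *v v)"
    using Suc norm_cauchy_schwarz[of v "?A *v v"] assms by simp
  then have "(r ^ 2 ^ k)\<^sup>2 \<le> (norm (?A *v v))\<^sup>2"
    using assms by (intro power_mono) auto
  also have "\<dots> = v \<bullet> ((?A ** ?A) *v v)"
    by (simp add: matrix_vector_mul_assoc[symmetric] symmetric_inner[OF A] power2_norm_eq_inner)
  also have "?A ** ?A = mat_pow P (2 ^ Suc k)"
    by (simp only: mat_pow_add[symmetric] mult_2[symmetric] power_Suc)
  finally show ?case
    by (simp only: power_mult[symmetric] power_Suc mult.commute)
qed

text \<open>The exponent is even, so the trace is the squared Frobenius norm of the half power,
  which dominates the squared length of the image of \<open>v\<close>.\<close>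

lemma trace_pow_two_power_ge:
  fixes P :: "real ^ 'd ^ 'd"
  assumes sym: "transpose P = P" and v: "norm v = 1" and r: "0 \<le> r" "r \<le> v \<bullet> (P *v v)"
  shows "r ^ 2 ^ Suc k \<le> trace (mat_pow P (2 ^ Suc k))"
proof -
  let ?A = "mat_pow P (2 ^ k)"
  have A: "transpose ?A = ?A"
    by (simp add: transpose_mat_pow sym)
  have "r ^ 2 ^ k \<le> norm (?A *v v)"
    using rayleigh_pow_two_power[OF assms, of k] norm_cauchy_schwarz[of v "?A *v v"] v by simp
  also have "\<dots> \<le> norm ?A"
    using norm_matrix_vector_le[of ?A v] v by simp
  finally have "(r ^ 2 ^ k)\<^sup>2 \<le> (norm ?A)\<^sup>2"
    using r by (intro power_mono) auto
  also have "\<dots> = trace (?A ** ?A)"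
    using trace_mult_transpose[of ?A ?A] by (simp add: A power2_norm_eq_inner)
  also have "?A ** ?A = mat_pow P (2 ^ Suc k)"
    by (simp only: mat_pow_add[symmetric] mult_2[symmetric] power_Suc)
  finally show ?thesis
    by (simp only: power_mult[symmetric] power_Suc mult.commute)
qed

section \<open>Sums over index sequences and sums of matrices\<close>

text \<open>Plays the role of conditioning: with the first \<open>j\<close> indices fixed, the last
  one is averaged out.\<close>

lemma sum_PiE_lessThan_Suc:
  fixes g :: "(nat \<Rightarrow> 'i) \<Rightarrow> real"
  shows "(\<Sum>s\<in>PiE {..<Suc j} (\<lambda>_. D). g s) = (\<Sum>s\<in>PiE {..<j} (\<lambda>_. D). \<Sum>x\<in>D. g (s(j := x)))"
proof -
  have "inj_on (\<lambda>(x, s). s(j := x)) (D \<times> PiE {..<j} (\<lambda>_. D))"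
    by (rule inj_combinator) simp
  then have "(\<Sum>s\<in>PiE {..<Suc j} (\<lambda>_. D). g s) = (\<Sum>(x, s)\<in>D \<times> PiE {..<j} (\<lambda>_. D). g (s(j := x)))"
    unfolding lessThan_Suc PiE_insert_eq by (subst sum.reindex) (auto simp: case_prod_unfold)
  also have "\<dots> = (\<Sum>x\<in>D. \<Sum>s\<in>PiE {..<j} (\<lambda>_. D). g (s(j := x)))"
    by (simp add: sum.cartesian_product)
  finally show ?thesis
    by (simp add: sum.swap[of _ D])
qed

lemma transpose_add: "transpose (A + B) = transpose A + transpose B"
  for A B :: "real ^ 'd ^ 'd"
  by (simp add: transpose_def vec_eq_iff)

lemma transpose_sum: "transpose (\<Sum>i\<in>I. A i) = (\<Sum>i\<in>I. transpose (A i))"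
  for A :: "'i \<Rightarrow> real ^ 'd ^ 'd"
  by (simp add: transpose_def vec_eq_iff)

lemma matrix_sum_mult_ldistrib: "B ** (\<Sum>i\<in>I. A i) = (\<Sum>i\<in>I. B ** A i)"
  for A :: "'i \<Rightarrow> real ^ 'd ^ 'd"
  by (induction I rule: infinite_finite_induct)
    (simp_all add: matrix_add_ldistrib matrix_matrix_mult_def vec_eq_iff sum.distrib algebra_simps)

lemma trace_sum: "trace (\<Sum>i\<in>I. A i) = (\<Sum>i\<in>I. trace (A i))"
  for A :: "'i \<Rightarrow> real ^ 'd ^ 'd"
  unfolding trace_def by (simp add: sum.swap[of _ I])

lemma matrix_sum_vector_mult: "(\<Sum>i\<in>I. A i) *v v = (\<Sum>i\<in>I. A i *v v)"
  for A :: "'i \<Rightarrow> real ^ 'd ^ 'd"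
  by (induction I rule: infinite_finite_induct) (simp_all add: matrix_vector_mult_add_rdistrib)

section \<open>Tail bound for sums with negative drift\<close>

text \<open>For \<open>x\<close> uniform on a nonempty \<open>D\<close>, \<open>drift\<close> says
  that the expectation of \<open>X x\<close> plus its square is negative semidefinite; by symmetry
  \<open>(X x *v v) \<bullet> (X x *v v)\<close> is the form of the square.\<close>

locale negative_drift_family =
  fixes D :: "'i set" and X :: "'i \<Rightarrow> real ^ 'd ^ 'd"
  assumes finite_D: "finite D"
    and symmetric: "\<And>x. x \<in> D \<Longrightarrow> transpose (X x) = X x"
    and norm_le: "\<And>x v. x \<in> D \<Longrightarrow> norm (X x *v v) \<le> norm v"
    and drift: "\<And>v. (\<Sum>x\<in>D. v \<bullet> (X x *v v) + (X x *v v) \<bullet> (X x *v v)) \<le> 0"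
begin

text \<open>Stands for the statement that the expected matrix exponential of a summand is at most
  the identity: \<open>drift\<close> cancels the first and second order terms of
  \<open>mat_pow_quadratic_bound\<close>.\<close>

lemma sum_mat_pow_le:
  assumes "m \<ge> 1"
  shows "v \<bullet> ((\<Sum>x\<in>D. mat_pow (mat 1 + (1 / real m) *\<^sub>R X x) m) *v v) \<le> real (card D) * (v \<bullet> v)"
proof -
  have "v \<bullet> ((\<Sum>x\<in>D. mat_pow (mat 1 + (1 / real m) *\<^sub>R X x) m) *v v)
      = (\<Sum>x\<in>D. v \<bullet> (mat_pow (mat 1 + (1 / real m) *\<^sub>R X x) m *v v))"
    by (simp add: matrix_sum_vector_mult inner_sum_right)
  also have "\<dots> \<le> (\<Sum>x\<in>D. v \<bullet> v + v \<bullet> (X x *v v) + (X x *v v) \<bullet> (X x *v v))"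
    using assms by (intro sum_mono mat_pow_quadratic_bound symmetric norm_le)
  also have "\<dots> = real (card D) * (v \<bullet> v) + (\<Sum>x\<in>D. v \<bullet> (X x *v v) + (X x *v v) \<bullet> (X x *v v))"
    by (simp add: sum.distrib add.assoc)
  finally show ?thesis
    using drift[of v] by linarith
qed

text \<open>One step of the moment recursion. The trace inequality separates \<open>S\<close> from
  the new summand, which can then be summed over \<open>D\<close> on its own.\<close>

lemma sum_trace_product_le:
  assumes S: "transpose S = S" and m: "m = 2 ^ Suc k"
  shows "(\<Sum>x\<in>D. trace (mat_pow ((mat 1 + (1 / real m) *\<^sub>R S) ** (mat 1 + (1 / real m) *\<^sub>R X x)) m))
    \<le> real (card D) * trace (mat_pow (mat 1 + (1 / real m) *\<^sub>R S) m)"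
proof -
  let ?P = "\<lambda>A :: real ^ 'd ^ 'd. mat 1 + (1 / real m) *\<^sub>R A"
  let ?B = "mat_pow (?P S) (2 ^ k)"
  have sym: "transpose (?P A) = ?P A" if "transpose A = A" for A
    using that by (simp add: transpose_add transpose_scalar)
  \<comment> \<open>Evenness of \<open>m\<close> makes this power a square of a symmetric matrix, as
    \<open>trace_sandwich_le\<close> needs.\<close>
  have B: "mat_pow (?P S) m = ?B ** ?B"
    unfolding m by (simp only: mat_pow_add[symmetric] mult_2[symmetric] power_Suc)
  have "(\<Sum>x\<in>D. trace (mat_pow (?P S ** ?P (X x)) m)) \<le>
      (\<Sum>x\<in>D. trace (mat_pow (?P S) m ** mat_pow (?P (X x)) m))"
    unfolding m by (intro sum_mono trace_pow_product_le sym[unfolded m] S symmetric)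
  also have "\<dots> = trace (?B ** ?B ** (\<Sum>x\<in>D. mat_pow (?P (X x)) m))"
    by (simp only: B trace_sum matrix_sum_mult_ldistrib)
  also have "\<dots> \<le> real (card D) * trace (?B ** ?B)"
  proof (intro trace_sandwich_le sum_mat_pow_le)
    show "transpose ?B = ?B"
      by (simp only: transpose_mat_pow sym[OF S])
    show "m \<ge> 1"
      by (simp add: m)
  qed
  finally show ?thesis
    unfolding B .
qed

abbreviation partial_sum :: "nat \<Rightarrow> (nat \<Rightarrow> 'i) \<Rightarrow> real ^ 'd ^ 'd" where
  "partial_sum n s \<equiv> \<Sum>i<n. X (s i)"

lemma transpose_partial_sum:
  assumes "s \<in> PiE {..<n} (\<lambda>_. D)"
  shows "transpose (partial_sum n s) = partial_sum n s"
  unfolding transpose_sum using assms by (intro sum.cong symmetric) (auto simp: PiE_def)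

text \<open>Left unnormalised: dividing by \<open>real (card D) ^ n\<close> gives the expected trace
  of the substitute exponential of the partial sum.\<close>

definition moment :: "nat \<Rightarrow> nat \<Rightarrow> real" where
  "moment n m = (\<Sum>s\<in>PiE {..<n} (\<lambda>_. D). trace (mat_pow (mat 1 + (1 / real m) *\<^sub>R partial_sum n s) m))"

text \<open>For fixed \<open>m\<close> the substitute exponential of a sum is not the product of the
  factors, so each added summand costs a Lie-Trotter error. For fixed \<open>n\<close> there are
  finitely many such errors and their total vanishes as \<open>k\<close> grows.\<close>

lemma moment_le:
  "\<exists>err. err \<longlonglongrightarrow> 0 \<and>
    (\<forall>k. moment n (2 ^ Suc k) \<le> real (card D) ^ n * real CARD('d) + err k)"
proof (induction n)
  case 0
  have one: "mat_pow (mat 1 :: real ^ 'd ^ 'd) m = mat 1" for m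
    by (induction m) simp_all
  show ?case
    by (intro exI[of _ "\<lambda>_. 0"]) (simp add: moment_def one trace_I)
next
  case (Suc n)
  obtain err where err: "err \<longlonglongrightarrow> 0"
    and le: "\<And>k. moment n (2 ^ Suc k) \<le> real (card D) ^ n * real CARD('d) + err k"
    using Suc by blast
  let ?P = "\<lambda>m A :: real ^ 'd ^ 'd. mat 1 + (1 / real m) *\<^sub>R A"
  define gap where "gap s x m = trace (mat_pow (?P m (partial_sum n s + X x)) m) -
    trace (mat_pow (?P m (partial_sum n s) ** ?P m (X x)) m)" for s x m
  \<comment> \<open>The old error is multiplied by the number of choices for the new index; the new
    gaps are added over all sequences.\<close>
  define err' where "err' k = real (card D) * err k +
    (\<Sum>s\<in>PiE {..<n} (\<lambda>_. D). \<Sum>x\<in>D. gap s x (2 ^ Suc k))" for k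
  have pow: "filterlim (\<lambda>k. 2 ^ Suc k :: nat) sequentially sequentially"
    by (rule filterlim_subseq) (simp add: strict_mono_Suc_iff)
  have "(\<lambda>k. gap s x (2 ^ Suc k)) \<longlonglongrightarrow> 0" for s x
    unfolding gap_def by (rule filterlim_compose[OF lie_trotter_trace pow])
  then have "err' \<longlonglongrightarrow> real (card D) * 0 + (\<Sum>s\<in>PiE {..<n} (\<lambda>_. D). \<Sum>x\<in>D. 0)"
    unfolding err'_def by (intro tendsto_intros err)
  moreover have "moment (Suc n) (2 ^ Suc k) \<le> real (card D) ^ Suc n * real CARD('d) + err' k" for k
  proof -
    let ?m = "2 ^ Suc k :: nat"
    have eq: "partial_sum (Suc n) (s(n := x)) = partial_sum n s + X x" for s x
      by simp
    have "moment (Suc n) ?m = (\<Sum>s\<in>PiE {..<n} (\<lambda>_. D). \<Sum>x\<in>D.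
        trace (mat_pow (?P ?m (partial_sum n s + X x)) ?m))"
      unfolding moment_def sum_PiE_lessThan_Suc eq ..
    also have "\<dots> = (\<Sum>s\<in>PiE {..<n} (\<lambda>_. D). \<Sum>x\<in>D.
        trace (mat_pow (?P ?m (partial_sum n s) ** ?P ?m (X x)) ?m)) +
        (\<Sum>s\<in>PiE {..<n} (\<lambda>_. D). \<Sum>x\<in>D. gap s x ?m)"
      unfolding sum.distrib[symmetric] gap_def by simp
    also have "(\<Sum>s\<in>PiE {..<n} (\<lambda>_. D). \<Sum>x\<in>D.
        trace (mat_pow (?P ?m (partial_sum n s) ** ?P ?m (X x)) ?m)) \<le>
        (\<Sum>s\<in>PiE {..<n} (\<lambda>_. D). real (card D) * trace (mat_pow (?P ?m (partial_sum n s)) ?m))"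
      by (intro sum_mono sum_trace_product_le[where k = k] transpose_partial_sum refl)
    also have "\<dots> = real (card D) * moment n ?m"
      by (simp only: moment_def sum_distrib_left)
    also have "\<dots> \<le> real (card D) * (real (card D) ^ n * real CARD('d) + err k)"
      by (intro mult_left_mono le) simp
    finally show ?thesis
      by (simp add: err'_def algebra_simps)
  qed
  ultimately show ?case by auto
qed

text \<open>Markov's inequality for the trace moment: every bad sequence contributes at least (1 +
  t/m)^m, which tends to exp t as \<open>k\<close> grows, while the moment bound loses its error
  term.\<close>

lemma card_deviation_le:
  assumes t: "t \<ge> 0"
  shows "real (card {s \<in> PiE {..<n} (\<lambda>_. D). \<exists>v. t * (v \<bullet> v) < v \<bullet> (partial_sum n s *v v)})
    \<le> real CARD('d) * exp (- t) * real (card D) ^ n"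
proof -
  let ?bad = "{s \<in> PiE {..<n} (\<lambda>_. D). \<exists>v. t * (v \<bullet> v) < v \<bullet> (partial_sum n s *v v)}"
  let ?P = "\<lambda>m A :: real ^ 'd ^ 'd. mat 1 + (1 / real m) *\<^sub>R A"
  obtain err where err: "err \<longlonglongrightarrow> 0"
    and le: "\<And>k. moment n (2 ^ Suc k) \<le> real (card D) ^ n * real CARD('d) + err k"
    using moment_le by blast
  have pow: "filterlim (\<lambda>k. 2 ^ Suc k :: nat) sequentially sequentially"
    by (rule filterlim_subseq) (simp add: strict_mono_Suc_iff)
  have fin: "finite (PiE {..<n} (\<lambda>_. D))"
    by (intro finite_PiE finite_D) simp
  have sym: "transpose (?P m (partial_sum n s)) = ?P m (partial_sum n s)"
    if "s \<in> PiE {..<n} (\<lambda>_. D)" for m s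
    using transpose_partial_sum[OF that] by (simp add: transpose_add transpose_scalar)
  have "real (card ?bad) * (1 + t / real (2 ^ Suc k)) ^ 2 ^ Suc k \<le>
      real (card D) ^ n * real CARD('d) + err k" for k
  proof -
    let ?m = "2 ^ Suc k :: nat"
    \<comment> \<open>Nonnegative traces allow the remaining sequences to be dropped from the
      moment.\<close>
    have pos: "0 \<le> trace (mat_pow (?P ?m (partial_sum n s)) ?m)"
      if s: "s \<in> PiE {..<n} (\<lambda>_. D)" for s
    proof -
      let ?A = "mat_pow (?P ?m (partial_sum n s)) (2 ^ k)"
      have "mat_pow (?P ?m (partial_sum n s)) ?m = ?A ** transpose ?A"
        unfolding transpose_mat_pow sym[OF s]
        by (simp only: mat_pow_add[symmetric] mult_2[symmetric] power_Suc)
      then show ?thesis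
        by (simp only: trace_mult_transpose inner_ge_zero)
    qed
    have "(1 + t / real ?m) ^ ?m \<le> trace (mat_pow (?P ?m (partial_sum n s)) ?m)"
      if s: "s \<in> ?bad" for s
    proof -
      obtain v where v: "t * (v \<bullet> v) < v \<bullet> (partial_sum n s *v v)"
        using s by blast
      \<comment> \<open>The strict inequality excludes the zero vector, so \<open>v\<close> can be
        normalised.\<close>
      then have "v \<noteq> 0" by auto
      define u where "u = v /\<^sub>R norm v"
      have u: "norm u = 1" and v_eq: "v = norm v *\<^sub>R u"
        using \<open>v \<noteq> 0\<close> by (simp_all add: u_def)
      have "(norm v)\<^sup>2 * t \<le> (norm v)\<^sup>2 * (u \<bullet> (partial_sum n s *v u))"
        using v u by (subst (asm) (1 2 3 4) v_eq)
          (simp add: matrix_vector_mult_scaleR power2_eq_square dot_square_norm mult_ac)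
      then have "t \<le> u \<bullet> (partial_sum n s *v u)"
        using \<open>v \<noteq> 0\<close> by simp
      then have ray: "1 + t / real ?m \<le> u \<bullet> (?P ?m (partial_sum n s) *v u)"
        using u by (simp add: matrix_vector_mult_add_rdistrib scaleR_matrix_vector_assoc[symmetric]
            inner_add_right dot_square_norm divide_right_mono)
      have "s \<in> PiE {..<n} (\<lambda>_. D)"
        using s by blast
      moreover have "0 \<le> 1 + t / real ?m"
        using t by simp
      ultimately show ?thesis
        by (intro trace_pow_two_power_ge[OF sym u] ray)
    qed
    then have "real (card ?bad) * (1 + t / real ?m) ^ ?m \<le>
        (\<Sum>s\<in>?bad. trace (mat_pow (?P ?m (partial_sum n s)) ?m))"
      using sum_mono[of ?bad "\<lambda>_. (1 + t / real ?m) ^ ?m"] by simp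
    also have "\<dots> \<le> moment n ?m"
      unfolding moment_def by (intro sum_mono2 fin pos) auto
    finally show ?thesis using le[of k] by linarith
  qed
  moreover have "(\<lambda>k. real (card ?bad) * (1 + t / real (2 ^ Suc k)) ^ 2 ^ Suc k)
      \<longlonglongrightarrow> real (card ?bad) * exp t"
    by (intro tendsto_mult tendsto_const filterlim_compose[OF tendsto_exp_limit_sequentially pow])
  moreover have "(\<lambda>k. real (card D) ^ n * real CARD('d) + err k) \<longlonglongrightarrow> real (card D) ^ n * real CARD('d) + 0"
    by (intro tendsto_intros err)
  ultimately have "real (card ?bad) * exp t \<le> real (card D) ^ n * real CARD('d)"
    by (intro LIMSEQ_le[of _ _ _ "real (card D) ^ n * real CARD('d) + 0", simplified]) auto
  then show ?thesis
    by (simp add: exp_minus field_simps)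
qed

end

section \<open>Subsampled Hessians\<close>

lemma loewner_leI:
  fixes A B :: "real ^ 'd ^ 'd"
  assumes "transpose A = A" "transpose B = B" "\<And>v. v \<bullet> (A *v v) \<le> v \<bullet> (B *v v)"
  shows "A \<preceq> B"
proof -
  have "transpose (B - A) = transpose B - transpose A"
    by (simp add: transpose_def vec_eq_iff)
  then show ?thesis
    using assms by (simp add: loewner_le_def matrix_vector_mult_diff_rdistrib inner_diff_right)
qed

lemma transpose_outer: "transpose (outer v) = outer v"
  by (simp add: transpose_def outer_def vec_eq_iff mult.commute)

lemma transpose_avg_hessian: "transpose (avg_hessian lam m a) = avg_hessian lam m a"
  by (simp only: avg_hessian_def transpose_add transpose_scalar transpose_sum transpose_outer
      transpose_mat)

lemma avg_hessian_quadratic_form: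
  "v \<bullet> (avg_hessian lam m a *v v) = (\<Sum>i<m. (a i \<bullet> v)\<^sup>2) / real m + lam * (v \<bullet> v)"
  unfolding avg_hessian_mult_vec
  by (simp add: inner_add_right inner_sum_right inner_commute[of v "a _"] power2_eq_square)

text \<open>A quadratic regulariser merely raises \<open>lam\<close>. The reference function is thus
  itself an averaged loss, and \<open>has_hessian_avg_loss\<close> supplies its Hessian.\<close>

lemma avg_hessian_shift: "avg_hessian (lam + \<mu>) m a = avg_hessian lam m a + \<mu> *\<^sub>R mat 1"
  unfolding avg_hessian_def scaleR_add_left add.assoc ..

lemma avg_loss_shift:
  assumes "m > 0"
  shows "avg_loss (lam + \<mu>) m z x = avg_loss lam m z x + \<mu> / 2 * (norm x)\<^sup>2"
proof -
  have "(\<Sum>i<m. sample_loss (lam + \<mu>) x (z i)) =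
      (\<Sum>i<m. sample_loss lam x (z i)) + real m * (\<mu> / 2 * (norm x)\<^sup>2)"
    by (simp add: sample_loss_def sum.distrib algebra_simps add_divide_distrib)
  then show ?thesis
    using assms by (simp add: avg_loss_def add_divide_distrib)
qed

text \<open>With G the mean of the outer products, the summand \<theta> (\<alpha> G + \<beta> a a^T)
  has mean \<theta> (\<alpha> + \<beta>) G. By \<open>cross\<close> and the norm bound
  \<open>R\<close>, its second moment is at most \<theta>^2 \<beta>^2 R^2 G. Thus
  \<open>drift\<close> makes the sum of both nonpositive, and \<open>small\<close> makes the summand
  a contraction.\<close>

lemma card_sample_deviation_le:
  fixes a :: "nat \<Rightarrow> real ^ 'd"
  assumes N: "N > 0" and a: "\<And>i. i < N \<Longrightarrow> norm (a i) \<le> R"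
    and th: "\<theta> \<ge> 0" and t: "t \<ge> 0"
    and small: "\<theta> * R\<^sup>2 * (\<bar>\<alpha>\<bar> + \<bar>\<beta>\<bar>) \<le> 1"
    and drift: "\<theta> * R\<^sup>2 * \<beta>\<^sup>2 + \<alpha> + \<beta> \<le> 0"
    and cross: "\<alpha>\<^sup>2 + 2 * \<alpha> * \<beta> \<le> 0"
  shows "real (card {s \<in> PiE {..<n} (\<lambda>_. {..<N}). \<exists>v. t * (v \<bullet> v) <
      \<theta> * (real n * \<alpha> * ((\<Sum>x<N. (a x \<bullet> v)\<^sup>2) / real N) + \<beta> * (\<Sum>i<n. (a (s i) \<bullet> v)\<^sup>2))})
    \<le> real CARD('d) * exp (- t) * real N ^ n"
proof -
  define G where "G = avg_hessian 0 N a"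
  define X where "X x = \<theta> *\<^sub>R (\<alpha> *\<^sub>R G + \<beta> *\<^sub>R outer (a x))" for x
  define q where "q v = (\<Sum>x<N. (a x \<bullet> v)\<^sup>2) / real N" for v
  define y where "y x v = (a x \<bullet> v) *\<^sub>R a x" for x v
  have Xv: "X x *v v = \<theta> *\<^sub>R (\<alpha> *\<^sub>R (G *v v) + \<beta> *\<^sub>R y x v)" for x v
    by (simp add: X_def matrix_vector_mult_add_rdistrib scaleR_matrix_vector_assoc[symmetric]
        outer_mult_vec y_def)
  have Gv: "real N *\<^sub>R (G *v v) = (\<Sum>x<N. y x v)" for v
    using N by (simp add: G_def avg_hessian_mult_vec y_def)
  have vG: "v \<bullet> (G *v v) = q v" for v
    by (simp add: G_def avg_hessian_quadratic_form q_def)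
  have vy: "v \<bullet> y x v = (a x \<bullet> v)\<^sup>2" for x v
    by (simp add: y_def inner_commute[of v] power2_eq_square)
  have y_norm: "norm (y x v) \<le> R\<^sup>2 * norm v" if "x < N" for x v
  proof -
    have "norm (y x v) \<le> (norm (a x) * norm v) * norm (a x)"
      unfolding y_def norm_scaleR by (intro mult_right_mono Cauchy_Schwarz_ineq2) simp
    also have "\<dots> = (norm (a x))\<^sup>2 * norm v"
      by (simp add: power2_eq_square)
    also have "\<dots> \<le> R\<^sup>2 * norm v"
      using a[OF that] by (intro mult_right_mono power_mono) auto
    finally show ?thesis .
  qed
  have G_norm: "norm (G *v v) \<le> R\<^sup>2 * norm v" for v
  proof -
    have "real N * norm (G *v v) = norm (\<Sum>x<N. y x v)"
      unfolding Gv[symmetric] by simp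
    also have "\<dots> \<le> (\<Sum>x<N. R\<^sup>2 * norm v)"
      by (intro sum_norm_le y_norm) auto
    finally show ?thesis using N by simp
  qed
  interpret negative_drift_family "{..<N}" X
  proof
    show "transpose (X x) = X x" for x
      by (simp add: X_def G_def transpose_add transpose_scalar transpose_outer transpose_avg_hessian)
    show "norm (X x *v v) \<le> norm v" if "x \<in> {..<N}" for x v
    proof -
      have "norm (X x *v v) \<le> \<theta> * (\<bar>\<alpha>\<bar> * norm (G *v v) + \<bar>\<beta>\<bar> * norm (y x v))"
        unfolding Xv using th norm_triangle_ineq[of "\<alpha> *\<^sub>R (G *v v)" "\<beta> *\<^sub>R y x v"]
        by (simp add: mult_left_mono)
      also have "\<dots> \<le> \<theta> * (\<bar>\<alpha>\<bar> * (R\<^sup>2 * norm v) + \<bar>\<beta>\<bar> * (R\<^sup>2 * norm v))"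
        using th that by (intro mult_left_mono add_mono G_norm y_norm) auto
      also have "\<dots> = (\<theta> * R\<^sup>2 * (\<bar>\<alpha>\<bar> + \<bar>\<beta>\<bar>)) * norm v"
        by (simp add: algebra_simps)
      also have "\<dots> \<le> 1 * norm v"
        by (intro mult_right_mono small) simp
      finally show ?thesis by simp
    qed
    show "(\<Sum>x<N. v \<bullet> (X x *v v) + (X x *v v) \<bullet> (X x *v v)) \<le> 0" for v
    proof -
      let ?g = "G *v v"
      have "(\<Sum>x<N. v \<bullet> (X x *v v)) = (\<Sum>x<N. \<theta> * \<alpha> * q v + \<theta> * \<beta> * (a x \<bullet> v)\<^sup>2)"
        by (simp add: Xv inner_add_right vG vy algebra_simps)
      also have "\<dots> = real N * (\<theta> * \<alpha> * q v) + \<theta> * \<beta> * (\<Sum>x<N. (a x \<bullet> v)\<^sup>2)"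
        by (simp add: sum.distrib sum_distrib_left)
      also have "(\<Sum>x<N. (a x \<bullet> v)\<^sup>2) = real N * q v"
        using N by (simp add: q_def)
      finally have "(\<Sum>x<N. v \<bullet> (X x *v v)) = \<theta> * real N * (\<alpha> + \<beta>) * q v"
        by (simp add: algebra_simps)
      moreover have "(\<Sum>x<N. (X x *v v) \<bullet> (X x *v v)) \<le> \<theta>\<^sup>2 * \<beta>\<^sup>2 * R\<^sup>2 * real N * q v"
      proof -
        have "(\<Sum>x<N. (X x *v v) \<bullet> (X x *v v)) = (\<Sum>x<N. \<theta>\<^sup>2 * (\<alpha>\<^sup>2 * (?g \<bullet> ?g) +
            2 * \<alpha> * \<beta> * (?g \<bullet> y x v) + \<beta>\<^sup>2 * (y x v \<bullet> y x v)))"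
          by (simp add: Xv inner_add_left inner_add_right inner_commute[of "y _ v" ?g]
              power2_eq_square algebra_simps)
        also have "\<dots> = \<theta>\<^sup>2 * (\<alpha>\<^sup>2 * (?g \<bullet> ?g) * real N +
            2 * \<alpha> * \<beta> * (?g \<bullet> (\<Sum>x<N. y x v)) + \<beta>\<^sup>2 * (\<Sum>x<N. y x v \<bullet> y x v))"
          by (simp add: sum.distrib sum_distrib_left[symmetric] inner_sum_right)
        \<comment> \<open>Since \<open>?g\<close> is the mean of the \<open>y x v\<close>, the mixed
          term is a multiple of \<open>?g \<bullet> ?g\<close> and joins the first one;
          \<open>cross\<close> then disposes of both.\<close>
        also have "\<dots> = \<theta>\<^sup>2 * ((\<alpha>\<^sup>2 + 2 * \<alpha> * \<beta>) * (real N * (?g \<bullet> ?g)) + \<beta>\<^sup>2 * (\<Sum>x<N. y x v \<bullet> y x v))"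
          unfolding Gv[symmetric] by (simp add: algebra_simps)
        also have "\<dots> \<le> \<theta>\<^sup>2 * (0 + \<beta>\<^sup>2 * (\<Sum>x<N. R\<^sup>2 * (a x \<bullet> v)\<^sup>2))"
        proof (intro mult_left_mono add_mono sum_mono)
          show "(\<alpha>\<^sup>2 + 2 * \<alpha> * \<beta>) * (real N * (?g \<bullet> ?g)) \<le> 0"
            using cross by (intro mult_nonpos_nonneg) auto
          show "y x v \<bullet> y x v \<le> R\<^sup>2 * (a x \<bullet> v)\<^sup>2" if "x \<in> {..<N}" for x
          proof -
            have "y x v \<bullet> y x v = (norm (a x))\<^sup>2 * (a x \<bullet> v)\<^sup>2"
              by (simp add: y_def dot_square_norm power2_eq_square)
            also have "\<dots> \<le> R\<^sup>2 * (a x \<bullet> v)\<^sup>2"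
              using a that by (intro mult_right_mono power_mono) auto
            finally show ?thesis .
          qed
        qed auto
        also have "\<dots> = \<theta>\<^sup>2 * \<beta>\<^sup>2 * R\<^sup>2 * real N * q v"
          using N by (simp add: sum_distrib_left[symmetric] q_def)
        finally show ?thesis .
      qed
      ultimately have "(\<Sum>x<N. v \<bullet> (X x *v v) + (X x *v v) \<bullet> (X x *v v)) \<le>
          \<theta> * real N * (\<alpha> + \<beta>) * q v + \<theta>\<^sup>2 * \<beta>\<^sup>2 * R\<^sup>2 * real N * q v"
        by (simp add: sum.distrib)
      also have "\<dots> = (\<theta> * real N * q v) * (\<theta> * R\<^sup>2 * \<beta>\<^sup>2 + \<alpha> + \<beta>)"
        by (simp add: algebra_simps power2_eq_square)
      also have "\<dots> \<le> 0"
        using th drift by (intro mult_nonneg_nonpos mult_nonneg_nonneg) (auto simp: q_def sum_nonneg)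
      finally show ?thesis .
    qed
  qed simp
  have "v \<bullet> (partial_sum n s *v v) = \<theta> * (real n * \<alpha> * q v + \<beta> * (\<Sum>i<n. (a (s i) \<bullet> v)\<^sup>2))" for s v
    by (simp add: matrix_sum_vector_mult inner_sum_right Xv inner_add_right vG vy
        sum_distrib_left[symmetric] sum.distrib)
  then show ?thesis
    using card_deviation_le[OF t, of n] by (simp add: q_def)
qed

section \<open>From counting index sequences to probability\<close>

text \<open>Each sequence of indices below \<open>N\<close> is drawn with probability
  \<open>1 / real N ^ n\<close>, and the corresponding events are disjoint. Restricting to the first
  \<open>n\<close> indices leaves countably many outcomes, which makes the event measurable for any
  \<open>\<Phi>\<close>.\<close>

lemma (in prob_space) prob_uniform_sample_ge:
  fixes S :: "nat \<Rightarrow> 'a \<Rightarrow> nat" and \<Phi> :: "(nat \<Rightarrow> nat) \<Rightarrow> bool"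
  assumes N: "N > 0" and n: "n > 0"
    and indep: "indep_vars (\<lambda>_. count_space UNIV) S {..<n}"
    and unif: "\<And>i. i < n \<Longrightarrow> distr M (count_space UNIV) (S i) = measure_pmf (pmf_of_set {..<N})"
  shows "real (card {s \<in> PiE {..<n} (\<lambda>_. {..<N}). \<Phi> s}) / real N ^ n \<le>
    prob {\<omega> \<in> space M. \<Phi> (restrict (\<lambda>i. S i \<omega>) {..<n})}"
proof -
  have meas: "S i \<in> measurable M (count_space UNIV)" if "i < n" for i
    using indep that unfolding indep_vars_def by auto
  define E where "E s = {\<omega> \<in> space M. \<forall>i<n. S i \<omega> = s i}" for s
  have E_eq: "E s = (\<Inter>i<n. S i -` {s i} \<inter> space M)" for s
    using n by (auto simp: E_def)
  have E_event: "E s \<in> events" for s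
    unfolding E_eq using n meas by (intro sets.finite_INT) (auto intro!: measurable_sets)
  \<comment> \<open>The drawn indices may leave \<open>{..<N}\<close> on a null set, so the event is
    decomposed over \<open>?all\<close>, while only \<open>?good\<close> is counted.\<close>
  let ?good = "{s \<in> PiE {..<n} (\<lambda>_. {..<N}). \<Phi> s}" and ?all = "{s \<in> PiE {..<n} (\<lambda>_. UNIV). \<Phi> s}"
  have fin: "finite ?good"
    by (rule finite_subset[of _ "PiE {..<n} (\<lambda>_. {..<N})"]) (auto intro: finite_PiE)
  have "countable (PiE {..<n} (\<lambda>_. UNIV :: nat set))"
    by (intro countable_PiE) auto
  then have count: "countable ?all"
    by (rule countable_subset[rotated]) auto
  have eq: "{\<omega> \<in> space M. \<Phi> (restrict (\<lambda>i. S i \<omega>) {..<n})} = (\<Union>s\<in>?all. E s)"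
  proof (intro set_eqI iffI)
    fix \<omega> assume "\<omega> \<in> {\<omega> \<in> space M. \<Phi> (restrict (\<lambda>i. S i \<omega>) {..<n})}"
    then show "\<omega> \<in> (\<Union>s\<in>?all. E s)"
      by (intro UN_I[of "restrict (\<lambda>i. S i \<omega>) {..<n}"]) (auto simp: E_def)
  next
    fix \<omega> assume "\<omega> \<in> (\<Union>s\<in>?all. E s)"
    then obtain s where s: "s \<in> PiE {..<n} (\<lambda>_. UNIV)" "\<Phi> s" "\<omega> \<in> E s"
      by blast
    have "restrict (\<lambda>i. S i \<omega>) {..<n} = s"
      using s by (intro extensionalityI[of _ "{..<n}"]) (auto simp: E_def PiE_def)
    moreover have "\<omega> \<in> space M"
      using s by (auto simp: E_def)
    ultimately show "\<omega> \<in> {\<omega> \<in> space M. \<Phi> (restrict (\<lambda>i. S i \<omega>) {..<n})}"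
      using s by simp
  qed
  have prob_E: "prob (E s) = 1 / real N ^ n" if s: "s \<in> PiE {..<n} (\<lambda>_. {..<N})" for s
  proof -
    have "prob (S i -` {s i} \<inter> space M) = 1 / real N" if i: "i < n" for i
    proof -
      have "prob (S i -` {s i} \<inter> space M) = measure (distr M (count_space UNIV) (S i)) {s i}"
        using meas[OF i] by (simp add: measure_distr)
      also have "\<dots> = pmf (pmf_of_set {..<N}) (s i)"
        unfolding unif[OF i] by (rule measure_pmf_single)
      also have "\<dots> = 1 / real N"
        using N PiE_mem[OF s, of i] i by (subst pmf_of_set) (auto simp: lessThan_empty_iff)
      finally show ?thesis .
    qed
    moreover have "prob (E s) = (\<Prod>i<n. prob (S i -` {s i} \<inter> space M))"
      unfolding E_eq using n by (intro indep_varsD_finite[OF indep]) auto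
    ultimately show ?thesis
      by (simp add: power_one_over)
  qed
  have disj: "disjoint_family_on E ?good"
  proof (unfold disjoint_family_on_def, intro ballI impI)
    fix s s' assume *: "s \<in> ?good" "s' \<in> ?good" "s \<noteq> s'"
    then obtain i where "i < n" "s i \<noteq> s' i"
      using PiE_ext[of s "{..<n}" "\<lambda>_. {..<N}" s'] by auto
    then show "E s \<inter> E s' = {}"
      by (auto simp: E_def)
  qed
  have "real (card ?good) / real N ^ n = (\<Sum>s\<in>?good. prob (E s))"
    by (simp add: prob_E)
  also have "\<dots> = prob (\<Union>s\<in>?good. E s)"
    using fin disj E_event by (intro finite_measure_finite_Union[symmetric]) auto
  also have "\<dots> \<le> prob (\<Union>s\<in>?all. E s)"
    using count E_event by (intro finite_measure_mono sets.countable_UN') (auto simp: PiE_def)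
  finally show ?thesis
    unfolding eq .
qed

section \<open>The regularisation parameter and the condition number\<close>

lemma reg_mu_nonneg: "0 \<le> reg_mu d n R lam \<delta>"
  by (simp add: reg_mu_def)

lemma le_lam_plus_reg_mu:
  "28 * R\<^sup>2 / (3 * real n) * ln (2 * real d / \<delta>) \<le> lam + 2 * reg_mu d n R lam \<delta>"
  unfolding reg_mu_def max_def by (auto split: if_splits)

lemma reg_mu_le:
  assumes "lam \<ge> 0" "c \<ge> 0" "28 * R\<^sup>2 / (3 * real n) * ln (2 * real d / \<delta>) \<le> c"
  shows "reg_mu d n R lam \<delta> \<le> c / 2"
proof -
  have "max (28 * R\<^sup>2 / (3 * real n) * ln (2 * real d / \<delta>) - lam) 0 \<le> c"
    using assms by (intro max.boundedI) linarith+
  then show ?thesis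
    unfolding reg_mu_def by simp
qed

lemma rel_condition_number_le:
  "\<exists>C>0. \<forall>(d::nat) (k::nat) (\<rho>::real) (l::real) (\<epsilon>::real).
    d \<ge> 1 \<and> \<rho> > 0 \<and> l > 0 \<and> 0 < \<epsilon> \<and> \<epsilon> < 1 \<and> real d / \<epsilon> \<ge> 2 \<and>
    real k > 28 / 3 * ln (2 * real d / \<epsilon>) \<longrightarrow>
    2 / rel_sigma l (reg_mu d k \<rho> l \<epsilon>) \<le> C * (1 + (\<rho>\<^sup>2 / l) / real k * ln (real d / \<epsilon>))"
\<comment> \<open>The ratio equals 3 + 4 \<mu> / l, and \<mu> / l is at most 28/3 times the target
  term; 38 rounds up 4 * 28/3 and also covers the 3.\<close>
proof (intro exI[of _ 38] conjI allI impI)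
  fix d k :: nat and \<rho> l \<epsilon> :: real
  assume asm: "d \<ge> 1 \<and> \<rho> > 0 \<and> l > 0 \<and> 0 < \<epsilon> \<and> \<epsilon> < 1 \<and> real d / \<epsilon> \<ge> 2 \<and>
    real k > 28 / 3 * ln (2 * real d / \<epsilon>)"
  let ?\<mu> = "reg_mu d k \<rho> l \<epsilon>" and ?K = "(\<rho>\<^sup>2 / l) / real k" and ?L = "ln (real d / \<epsilon>)"
  have ln2: "ln 2 \<le> ?L"
    using asm by simp
  have "ln (2 * real d / \<epsilon>) = ln (2 * (real d / \<epsilon>))"
    by simp
  also have "\<dots> = ln 2 + ?L"
    using asm by (intro ln_mult_pos) auto
  finally have L: "ln (2 * real d / \<epsilon>) = ln 2 + ?L" .
  have "0 < ln (2::real)"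
    by simp
  \<comment> \<open>The regime \<open>real d / \<epsilon> \<ge> 2\<close> is what absorbs the
    additive \<open>ln 2\<close> into a factor 2.\<close>
  then have pos: "0 < ?L" "0 < ln (2 * real d / \<epsilon>)" "ln (2 * real d / \<epsilon>) \<le> 2 * ?L"
    using ln2 L by linarith+
  have k: "real k > 0"
    using asm pos by (smt (verit) mult_pos_pos divide_pos_pos)
  have K: "?K \<ge> 0"
    using asm by simp
  define A where "A = ?K * l * ln (2 * real d / \<epsilon>)"
  have "28 * \<rho>\<^sup>2 / (3 * real k) * ln (2 * real d / \<epsilon>) = 28 / 3 * A"
    using asm by (simp add: A_def)
  moreover have "0 \<le> A"
    unfolding A_def using K asm pos by (intro mult_nonneg_nonneg) auto
  ultimately have "?\<mu> \<le> 28 / 3 * A / 2"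
    using asm by (intro reg_mu_le) auto
  also have "\<dots> = 14 / 3 * ?K * l * ln (2 * real d / \<epsilon>)"
    by (simp add: A_def)
  also have "\<dots> \<le> 14 / 3 * ?K * l * (2 * ?L)"
    using K asm pos by (intro mult_left_mono mult_nonneg_nonneg) auto
  finally have "?\<mu> / l \<le> 28 / 3 * ?K * ?L"
    using asm by (simp add: pos_divide_le_eq mult_ac)
  then have "3 + 4 * (?\<mu> / l) \<le> 38 * (1 + ?K * ?L)"
    using mult_nonneg_nonneg[OF K, of ?L] pos by (simp add: algebra_simps)
  moreover have "2 / rel_sigma l ?\<mu> = 3 + 4 * (?\<mu> / l)"
    unfolding rel_sigma_def divide_inverse[of 2] inverse_inverse_eq by simp
  ultimately show "2 / rel_sigma l ?\<mu> \<le> 38 * (1 + ?K * ?L)"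
    by simp
qed simp

section \<open>Loewner bounds and the union bound\<close>

text \<open>The deterministic part. The slack \<gamma> is paid by lam + 2 \<mu>: in
  \<open>lower\<close> this fills up 2 (lam + \<mu>), and in \<open>upper\<close> half of it raises
  lam + \<mu> to 3/2 lam + 2 \<mu>, which is lam times the inverse of
  \<open>rel_sigma lam \<mu>\<close>.\<close>

lemma hessian_sandwich:
  fixes a :: "nat \<Rightarrow> real ^ 'd"
  defines "q \<equiv> \<lambda>m c v. (\<Sum>i<m. (c i \<bullet> v)\<^sup>2) / real m"
  assumes lam: "lam > 0" and mu: "\<mu> \<ge> 0" "\<gamma> \<le> lam + 2 * \<mu>"
    and lower: "\<And>v. q N a v - 2 * q n c v \<le> \<gamma> * (v \<bullet> v)"
    and upper: "\<And>v. q n c v - 3 / 2 * q N a v \<le> \<gamma> / 2 * (v \<bullet> v)"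
  shows "rel_sigma lam \<mu> *\<^sub>R (avg_hessian lam n c + \<mu> *\<^sub>R mat 1) \<preceq> avg_hessian lam N a"
    and "avg_hessian lam N a \<preceq> 2 *\<^sub>R (avg_hessian lam n c + \<mu> *\<^sub>R mat 1)"
proof -
  have form: "v \<bullet> (avg_hessian l m b *v v) = q m b v + l * (v \<bullet> v)" for l m b and v :: "real ^ 'd"
    by (simp add: avg_hessian_quadratic_form q_def)
  have gam: "\<gamma> * (v \<bullet> v) \<le> (lam + 2 * \<mu>) * (v \<bullet> v)" for v :: "real ^ 'd"
    using mu by (intro mult_right_mono) auto
  have s: "3 / 2 + 2 * \<mu> / lam > 0"
    using lam mu by (intro add_pos_nonneg) auto
  show "avg_hessian lam N a \<preceq> 2 *\<^sub>R (avg_hessian lam n c + \<mu> *\<^sub>R mat 1)"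
    unfolding avg_hessian_shift[symmetric]
  proof (rule loewner_leI)
    show "v \<bullet> (avg_hessian lam N a *v v) \<le> v \<bullet> ((2 *\<^sub>R avg_hessian (lam + \<mu>) n c) *v v)" for v
      using lower[of v] gam[of v]
      by (simp add: scaleR_matrix_vector_assoc[symmetric] form algebra_simps)
  qed (simp_all add: transpose_scalar transpose_avg_hessian)
  show "rel_sigma lam \<mu> *\<^sub>R (avg_hessian lam n c + \<mu> *\<^sub>R mat 1) \<preceq> avg_hessian lam N a"
    unfolding avg_hessian_shift[symmetric]
  proof (rule loewner_leI)
    fix v :: "real ^ 'd"
    have "q N a v \<ge> 0"
      by (simp add: q_def sum_nonneg)
    \<comment> \<open>The surplus on the right-hand side when the factor 3/2 + 2 \<mu> / lam
      multiplies the data term as well.\<close>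
    then have "0 \<le> 2 * \<mu> / lam * q N a v"
      using lam mu by simp
    then have "q n c v + (lam + \<mu>) * (v \<bullet> v) \<le> (3 / 2 + 2 * \<mu> / lam) * (q N a v + lam * (v \<bullet> v))"
      using upper[of v] gam[of v] lam by (simp add: algebra_simps)
    then have "rel_sigma lam \<mu> * (q n c v + (lam + \<mu>) * (v \<bullet> v)) \<le> q N a v + lam * (v \<bullet> v)"
      using s by (simp add: rel_sigma_def inverse_eq_divide pos_divide_le_eq mult.commute)
    then show "v \<bullet> ((rel_sigma lam \<mu> *\<^sub>R avg_hessian (lam + \<mu>) n c) *v v) \<le> v \<bullet> (avg_hessian lam N a *v v)"
      by (simp add: scaleR_matrix_vector_assoc[symmetric] form)
  qed (simp_all add: transpose_scalar transpose_avg_hessian)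
qed

lemma one_le_two_mult_divide:
  fixes d :: nat and \<delta> :: real
  assumes "d \<ge> 1" "0 < \<delta>" "\<delta> < 1"
  shows "1 \<le> 2 * real d / \<delta>"
  unfolding pos_le_divide_eq[OF assms(2)] using assms by simp

text \<open>Union bound over two one-sided deviations, one for each Loewner inequality; each
  excludes at most a fraction \<delta> / 2 of the sequences.\<close>

lemma card_good_samples_ge:
  fixes a :: "nat \<Rightarrow> real ^ 'd"
  assumes N: "N > 0" and n: "n > 0" and R: "R > 0" and lam: "lam > 0"
    and \<delta>: "0 < \<delta>" "\<delta> < 1" and a: "\<And>i. i < N \<Longrightarrow> norm (a i) \<le> R"
  defines "\<mu> \<equiv> reg_mu CARD('d) n R lam \<delta>"
  shows "(1 - \<delta>) * real N ^ n \<le> real (card {s \<in> PiE {..<n} (\<lambda>_. {..<N}).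
    rel_sigma lam \<mu> *\<^sub>R (avg_hessian lam n (\<lambda>i. a (s i)) + \<mu> *\<^sub>R mat 1) \<preceq> avg_hessian lam N a \<and>
    avg_hessian lam N a \<preceq> 2 *\<^sub>R (avg_hessian lam n (\<lambda>i. a (s i)) + \<mu> *\<^sub>R mat 1)})"
    (is "_ \<le> real (card ?good)")
proof -
  \<comment> \<open>Chosen so that the tail \<open>real CARD('d) * exp (- t)\<close> equals
    \<open>\<delta> / 2\<close>.\<close>
  define t where "t = ln (2 * real CARD('d) / \<delta>)"
  define \<gamma> where "\<gamma> = 28 * R\<^sup>2 / (3 * real n) * t"
  define q where "q m c v = (\<Sum>i<m. (c i \<bullet> v)\<^sup>2) / real m" for m c and v :: "real ^ 'd"
  define all where "all = PiE {..<n} (\<lambda>_. {..<N})"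
  define bad where "bad \<theta> \<alpha> \<beta> = {s \<in> all. \<exists>v :: real ^ 'd. t * (v \<bullet> v) <
      \<theta> * (real n * \<alpha> * ((\<Sum>x<N. (a x \<bullet> v)\<^sup>2) / real N) + \<beta> * (\<Sum>i<n. (a (s i) \<bullet> v)\<^sup>2))}"
    for \<theta> \<alpha> \<beta>
  have d: "2 * real CARD('d) / \<delta> \<ge> 1"
    using \<delta> by (intro one_le_two_mult_divide) simp_all
  then have t: "t \<ge> 0"
    by (simp add: t_def)
  have exp_t: "real CARD('d) * exp (- t) = \<delta> / 2"
    using d \<delta> by (simp add: t_def exp_minus)
  have fin: "finite all"
    by (simp add: all_def finite_PiE)
  have q_n: "(\<Sum>i<n. (c i \<bullet> v)\<^sup>2) = real n * q n c v" for c and v :: "real ^ 'd"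
    using n by (simp add: q_def)
  \<comment> \<open>Here t / (\<theta> n) equals \<gamma>, the slack in \<open>lower\<close>; the
    drift condition reads 3/7 + 1 - 2 \<le> 0.\<close>
  have "real (card (bad (3 / (28 * R\<^sup>2)) 1 (- 2))) \<le> \<delta> / 2 * real N ^ n"
    unfolding bad_def all_def exp_t[symmetric] using R
    by (intro card_sample_deviation_le[where R = R] N a t) auto
  \<comment> \<open>Here t / (\<theta> n) equals \<gamma> / 2, the slack in \<open>upper\<close>;
    the drift condition reads 3/14 - 3/2 + 1 \<le> 0.\<close>
  moreover have "real (card (bad (3 / (14 * R\<^sup>2)) (- 3 / 2) 1)) \<le> \<delta> / 2 * real N ^ n"
    unfolding bad_def all_def exp_t[symmetric] using R
    by (intro card_sample_deviation_le[where R = R] N a t) (auto simp: power2_eq_square)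
  moreover have "all \<subseteq> ?good \<union> (bad (3 / (28 * R\<^sup>2)) 1 (- 2) \<union> bad (3 / (14 * R\<^sup>2)) (- 3 / 2) 1)"
  proof
    fix s assume s: "s \<in> all"
    let ?c = "\<lambda>i. a (s i)"
    {
      assume nb: "s \<notin> bad (3 / (28 * R\<^sup>2)) 1 (- 2)" "s \<notin> bad (3 / (14 * R\<^sup>2)) (- 3 / 2) 1"
      have mu: "\<mu> \<ge> 0" "\<gamma> \<le> lam + 2 * \<mu>"
        unfolding \<mu>_def \<gamma>_def t_def by (rule reg_mu_nonneg le_lam_plus_reg_mu)+
      have "q N a v - 2 * q n ?c v \<le> \<gamma> * (v \<bullet> v)" for v
      proof -
        have "3 / (28 * R\<^sup>2) * (real n * 1 * q N a v + (- 2) * (real n * q n ?c v)) \<le> t * (v \<bullet> v)"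
          using nb(1) s unfolding bad_def q_n by (auto simp: not_less q_def)
        then have "real n * (q N a v - 2 * q n ?c v) \<le> 28 * R\<^sup>2 / 3 * (t * (v \<bullet> v))"
          using R by (simp add: field_simps)
        then show ?thesis
          using n by (simp add: \<gamma>_def field_simps)
      qed
      moreover have "q n ?c v - 3 / 2 * q N a v \<le> \<gamma> / 2 * (v \<bullet> v)" for v
      proof -
        have "3 / (14 * R\<^sup>2) * (real n * (- 3 / 2) * q N a v + 1 * (real n * q n ?c v)) \<le> t * (v \<bullet> v)"
          using nb(2) s unfolding bad_def q_n by (auto simp: not_less q_def)
        then have "real n * (q n ?c v - 3 / 2 * q N a v) \<le> 14 * R\<^sup>2 / 3 * (t * (v \<bullet> v))"
          using R by (simp add: field_simps)
        then show ?thesis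
          using n by (simp add: \<gamma>_def field_simps)
      qed
      ultimately have "s \<in> ?good"
        unfolding q_def using s by (auto simp: all_def intro!: hessian_sandwich[OF lam mu])
    }
    then show "s \<in> ?good \<union> (bad (3 / (28 * R\<^sup>2)) 1 (- 2) \<union> bad (3 / (14 * R\<^sup>2)) (- 3 / 2) 1)"
      by blast
  qed
  then have "card all \<le> card ?good + (card (bad (3 / (28 * R\<^sup>2)) 1 (- 2)) + card (bad (3 / (14 * R\<^sup>2)) (- 3 / 2) 1))"
    using fin by (intro order_trans[OF card_mono order_trans[OF card_Un_le add_left_mono[OF card_Un_le]]])
      (auto simp: bad_def all_def[symmetric])
  moreover have "card all = N ^ n"
    by (simp add: all_def card_PiE)
  ultimately show ?thesis
    by (simp add: algebra_simps flip: of_nat_power)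
qed

theorem theorem2:
  fixes a :: "nat \<Rightarrow> real ^ 'd" and b :: "nat \<Rightarrow> real"
    and N n :: nat and R lam \<delta> :: real
    and M :: "'w measure" and S :: "nat \<Rightarrow> 'w \<Rightarrow> nat"
  defines "\<mu> \<equiv> reg_mu CARD('d) n R lam \<delta>"
    and "H\<^sub>F \<equiv> avg_hessian lam N a"
    and "H\<^sub>f \<equiv> \<lambda>\<omega>. avg_hessian lam n (\<lambda>i. a (S i \<omega>))"
    and "F \<equiv> avg_loss lam N (\<lambda>i. (a i, b i))"
    and "f \<equiv> \<lambda>\<omega>. avg_loss lam n (\<lambda>i. (a (S i \<omega>), b (S i \<omega>)))"
  assumes "N > 0" and "R > 0" and "lam > 0" and "0 < \<delta>" and "\<delta> < 1"
    and "\<And>i. i < N \<Longrightarrow> norm (a i) \<le> R"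
    and "real n > 28 / 3 * ln (2 * real CARD('d) / \<delta>)"
    and "prob_space M"
    and "prob_space.indep_vars M (\<lambda>_. count_space UNIV) S {..<n}"
    and "\<And>i. i < n \<Longrightarrow> distr M (count_space UNIV) (S i) = measure_pmf (pmf_of_set {..<N})"
  shows
    "measure M {\<omega> \<in> space M.
        rel_sigma lam \<mu> *\<^sub>R (H\<^sub>f \<omega> + \<mu> *\<^sub>R mat 1) \<preceq> H\<^sub>F \<and>
        H\<^sub>F \<preceq> 2 *\<^sub>R (H\<^sub>f \<omega> + \<mu> *\<^sub>R mat 1)} \<ge> 1 - \<delta> \<and>
     measure M {\<omega> \<in> space M.
        rel_smooth_strongly_convex F (\<lambda>x. f \<omega> x + \<mu> / 2 * (norm x)\<^sup>2) 2 (rel_sigma lam \<mu>)}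
       \<ge> 1 - \<delta> \<and>
     (\<exists>C>0. \<forall>(d::nat) (k::nat) (\<rho>::real) (l::real) (\<epsilon>::real).
        d \<ge> 1 \<and> \<rho> > 0 \<and> l > 0 \<and> 0 < \<epsilon> \<and> \<epsilon> < 1 \<and> real d / \<epsilon> \<ge> 2 \<and>
        real k > 28 / 3 * ln (2 * real d / \<epsilon>) \<longrightarrow>
        2 / rel_sigma l (reg_mu d k \<rho> l \<epsilon>) \<le> C * (1 + (\<rho>\<^sup>2 / l) / real k * ln (real d / \<epsilon>)))"
proof -
  interpret prob_space M by fact
  define good where "good s \<longleftrightarrow>
      rel_sigma lam \<mu> *\<^sub>R (avg_hessian lam n (\<lambda>i. a (s i)) + \<mu> *\<^sub>R mat 1) \<preceq> H\<^sub>F \<and>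
      H\<^sub>F \<preceq> 2 *\<^sub>R (avg_hessian lam n (\<lambda>i. a (s i)) + \<mu> *\<^sub>R mat 1)" for s
  have "1 \<le> 2 * real CARD('d) / \<delta>"
    using \<open>0 < \<delta>\<close> \<open>\<delta> < 1\<close> by (intro one_le_two_mult_divide) simp_all
  then have "0 \<le> ln (2 * real CARD('d) / \<delta>)"
    by simp
  then have n: "n > 0"
    using \<open>real n > 28 / 3 * ln (2 * real CARD('d) / \<delta>)\<close> by linarith
  \<comment> \<open>The averaged Hessian reads only indices below \<open>n\<close>, so the
    restriction in \<open>prob_uniform_sample_ge\<close> is invisible.\<close>
  have good_cong: "good (restrict s {..<n}) \<longleftrightarrow> good s" for s
    by (simp add: good_def avg_hessian_def)
  have "1 - \<delta> = (1 - \<delta>) * real N ^ n / real N ^ n"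
    using \<open>N > 0\<close> by simp
  also have "\<dots> \<le> real (card {s \<in> PiE {..<n} (\<lambda>_. {..<N}). good s}) / real N ^ n"
    unfolding good_def \<mu>_def H\<^sub>F_def using assms n
    by (intro divide_right_mono card_good_samples_ge) auto
  also have "\<dots> \<le> prob {\<omega> \<in> space M. good (restrict (\<lambda>i. S i \<omega>) {..<n})}"
    using assms n by (intro prob_uniform_sample_ge) auto
  finally have *: "1 - \<delta> \<le> prob {\<omega> \<in> space M. good (\<lambda>i. S i \<omega>)}"
    unfolding good_cong .
  \<comment> \<open>Hessians are unique, so this is an equivalence: both events of the claim are the
    same set, and one probability bound serves both.\<close>
  have "rel_smooth_strongly_convex F (\<lambda>x. f \<omega> x + \<mu> / 2 * (norm x)\<^sup>2) 2 (rel_sigma lam \<mu>)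
      \<longleftrightarrow> good (\<lambda>i. S i \<omega>)" for \<omega>
  proof -
    have F: "has_hessian F H\<^sub>F x" for x
      using has_hessian_avg_loss[OF \<open>N > 0\<close>, of lam "\<lambda>i. (a i, b i)" x] by (simp add: F_def H\<^sub>F_def)
    have \<phi>: "has_hessian (\<lambda>x. f \<omega> x + \<mu> / 2 * (norm x)\<^sup>2) (H\<^sub>f \<omega> + \<mu> *\<^sub>R mat 1) x" for x
      using has_hessian_avg_loss[OF n, of "lam + \<mu>" "\<lambda>i. (a (S i \<omega>), b (S i \<omega>))" x]
      by (simp add: f_def H\<^sub>f_def avg_loss_shift[OF n, abs_def] avg_hessian_shift)
    show ?thesis
      unfolding rel_smooth_strongly_convex_def good_def
      using F \<phi> has_hessian_unique[OF F] has_hessian_unique[OF \<phi>] unfolding H\<^sub>f_def by blast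
  qed
  then show ?thesis
    using * rel_condition_number_le by (simp add: good_def H\<^sub>f_def)
qed

end
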